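(* Consider the problem $\mathrm{Opt}=\min\{g(x): x\in X,\ P(x)\in K\}$ under the standing assumptions in the context, let $\sigma\in(0,1)$, $\delta\in(0,1]$, $x^0\in C$, and choose $t_0=\frac{\nu}{\Omega_g}$ and $\theta_0=\eta_0=2\Omega_g$. Then the method $\mathtt{Inexact\ Homotopy}(x^0,\varepsilon,f,\delta)$ (defined in the context) finds an $\varepsilon$-solution of the problem, and its total iteration complexity, i.e. the total number of conditional gradient steps performed in all calls of the inner procedure $\mathtt{ICG}$, is $$\mathtt{Compl}(x^0,\varepsilon,f,\delta)=O\left(\frac{\nu\,\Omega_g^2}{\delta^2\varepsilon^2(1-\sigma^2)}\right).$$
   Context: **Setting.** $E$ and $H$ are finite-dimensional Euclidean spaces; $E^*$ is the dual of $E$. For a differentiable function $f$, $f'(x)[h]$, $f''(x)[h_1,h_2]$, $f'''(x)[h_1,h_2,h_3]$ denote directional derivatives. For an open convex set $Q$, a function $f$ is self-concordant on $Q$ if it is (convex and) $C^3$ on $Q$ and $|f'''(x)[h,h,h]|\le 2(f''(x)[h,h])^{3/2}$ for all $x\in Q$ and all directions $h$. If $\mathrm{cl}(Q)$ is a closed convex pointed cone, $f$ is a $\nu$-canonical barrier for this cone (written $f\in\mathcal B_\nu$) if it is a self-concordant barrier on $Q$ (value $+\infty$ outside $Q$, tending to $+\infty$ at the boundary of $Q$) and $f(\tau x)=f(x)-\nu\log\tau$ for all $x\in Q$, $\tau>0$. **Standing assumptions.** (1) $g:E\to(-\infty,\infty]$ is proper, closed, convex and continuous on $\mathrm{dom}(g)$,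 and $\Omega_g:=\max_{x,y\in \mathrm{dom}(g)\cap X}|g(x)-g(y)|$ is finite. (2) $K\subset H$ is a closed convex pointed cone with nonempty interior, with a $\nu$-canonical barrier $f\in\mathcal B_\nu(K)$. (3) $P:E\to H$ is linear, and $F(x):=f(P(x))$ is a $\nu$-canonical barrier on the cone $P^{-1}(K)$; $\mathrm{dom}(F)=\mathrm{int}\,P^{-1}(K)$. (4) $X\subset E$ is nonempty, compact and convex, and $C:=X\cap\mathrm{dom}(F)\cap\mathrm{dom}(g)\ne\emptyset$. An $\varepsilon$-solution is a point $z\in X$ with $P(z)\in K$ and $g(z)-\mathrm{Opt}\le\varepsilon$. **Inexact oracle.** For $t>0$ and $x\in C$ let $\Gamma_t(x,s):=t^{-1}F'(x)[x-s]+g(x)-g(s)$ and $\mathrm{Gap}_t(x):=\max_{s\in X}\Gamma_t(x,s)$. For $\delta\in(0,1]$, $\theta>0$, a $(\delta,\theta)$-inexact linear minimization oracle returns, for each $x\in C$, a point $\tilde s_t(x)\in C$ with $$\widetilde{\mathrm{Gap}}_t(x):=\Gamma_t(x,\tilde s_t(x))\ \ge\ \delta\,(\mathrm{Gap}_t(x)-\theta).$$ **Procedure $\mathtt{ICG}(x^0,t,\eta,\delta,\theta)$** ($x^0\in C$; $t,\eta,\theta>0$; $\delta\in(0,1]$). With $\tilde s_t$ given by a $(\delta,\theta)$-inexact oracle, let $\tilde e_t(x):=\big(F''(x)[\tilde s_t(x)-x,\tilde s_t(x)-x]\big)^{1/2}$ and $$\tilde\alpha_t(x):=\min\Big\{1,\frac{t\,\widetilde{\mathrm{Gap}}_t(x)}{\tilde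 e_t(x)\,(\tilde e_t(x)+t\,\widetilde{\mathrm{Gap}}_t(x))}\Big\}$$ (with $\tilde\alpha_t(x)=1$ if $\tilde e_t(x)=0$). For $k=0,1,\dots$: if $\widetilde{\mathrm{Gap}}_t(x^k)>\eta\delta$, set $x^{k+1}=x^k+\tilde\alpha_t(x^k)(\tilde s_t(x^k)-x^k)$; otherwise stop and return the iteration index $k$ and the point $x^k$. **Method $\mathtt{Inexact\ Homotopy}(x^0,\varepsilon,f,\delta)$** (parameters $\varepsilon,t_0>0$, $\theta_0=\eta_0>0$, $\sigma\in(0,1)$). Set $x^0_{t_0}=x^0$ and $I=\big\lceil\log(3\eta_0/\varepsilon)/\log(1/\sigma)\big\rceil$. For $i=0,\dots,I-1$: let $\hat x_i$ be the point returned by $\mathtt{ICG}(x^0_{t_i},t_i,\eta_i,\delta,\theta_i)$, and set $t_{i+1}=t_i/\sigma$, $\eta_{i+1}=\sigma\eta_i$, $\theta_{i+1}=\sigma\theta_i$, $x^0_{t_{i+1}}=\hat x_i$. Output $\hat z=\hat x_I$, the point returned by $\mathtt{ICG}(x^0_{t_I},t_I,\eta_I,\delta,\theta_I)$. **Asymptotic notation.** $O(\cdot)$ is understood as $\varepsilon\downarrow0$ (leading-order term), with the problem data, $x^0$, $\delta$ and $\sigma$ fixed. It is assumed that $\Omega_g>0$, so that $t_0$ is defined. *)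

theory Defs
  imports "HOL-Analysis.Analysis" "HOL-Library.Landau_Symbols" "HOL-Library.While_Combinator"
    "HOL-Library.Monad_Syntax"
begin

subsection \<open>Extended-real-valued functions\<close>

definition edom :: "('a \<Rightarrow> ereal) \<Rightarrow> 'a set" where
  "edom f = {x. f x < \<infinity>}"

definition epi :: "('a \<Rightarrow> ereal) \<Rightarrow> ('a \<times> real) set" where
  "epi f = {(x, r). f x \<le> ereal r}"

definition proper_fun :: "('a \<Rightarrow> ereal) \<Rightarrow> bool" where
  "proper_fun f \<longleftrightarrow> (\<forall>x. f x \<noteq> -\<infinity>) \<and> edom f \<noteq> {}"

definition closed_fun :: "('a::topological_space \<Rightarrow> ereal) \<Rightarrow> bool" where
  "closed_fun f \<longleftrightarrow> closed (epi f)"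

definition convex_fun :: "('a::real_vector \<Rightarrow> ereal) \<Rightarrow> bool" where
  "convex_fun f \<longleftrightarrow> convex (epi f)"

text \<open>Real-valued version, only meaningful where \<open>f\<close> is finite; used to differentiate
  \<open>f\<close> at points of the (open) set on which it is finite.\<close>

definition fin :: "('a \<Rightarrow> ereal) \<Rightarrow> 'a \<Rightarrow> real" where
  "fin f x = real_of_ereal (f x)"

subsection \<open>Directional derivatives and self-concordant barriers\<close>

definition dir1 :: "('a::real_normed_vector \<Rightarrow> real) \<Rightarrow> 'a \<Rightarrow> 'a \<Rightarrow> real" where
  "dir1 f x h = frechet_derivative f (at x) h"

definition dir2 :: "('a::real_normed_vector \<Rightarrow> real) \<Rightarrow> 'a \<Rightarrow> 'a \<Rightarrow> 'a \<Rightarrow> real" where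
  "dir2 f x h1 h2 = dir1 (\<lambda>y. dir1 f y h1) x h2"

definition dir3 :: "('a::real_normed_vector \<Rightarrow> real) \<Rightarrow> 'a \<Rightarrow> 'a \<Rightarrow> 'a \<Rightarrow> 'a \<Rightarrow> real" where
  "dir3 f x h1 h2 h3 = dir1 (\<lambda>y. dir2 f y h1 h2) x h3"

text \<open>\<open>C\<^sup>k\<close> on an open set of a finite-dimensional space: continuity of the derivative is stated
  direction by direction.\<close>

primrec Ck_on :: "nat \<Rightarrow> ('a::euclidean_space \<Rightarrow> real) \<Rightarrow> 'a set \<Rightarrow> bool" where
  "Ck_on 0 f Q = continuous_on Q f"
| "Ck_on (Suc k) f Q =
    ((\<forall>x\<in>Q. f differentiable (at x)) \<and> (\<forall>h. Ck_on k (\<lambda>x. dir1 f x h) Q))"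

definition self_concordant_on :: "'a::euclidean_space set \<Rightarrow> ('a \<Rightarrow> real) \<Rightarrow> bool" where
  "self_concordant_on Q f \<longleftrightarrow>
     open Q \<and> convex Q \<and> convex_on Q f \<and> Ck_on 3 f Q \<and>
     (\<forall>x\<in>Q. \<forall>h. \<bar>dir3 f x h h h\<bar> \<le> 2 * (dir2 f x h h) powr (3 / 2))"

definition self_concordant_barrier :: "'a::euclidean_space set \<Rightarrow> ('a \<Rightarrow> ereal) \<Rightarrow> bool" where
  "self_concordant_barrier Q f \<longleftrightarrow>
     (\<forall>x\<in>Q. \<bar>f x\<bar> \<noteq> \<infinity>) \<and> (\<forall>x. x \<notin> Q \<longrightarrow> f x = \<infinity>) \<and>
     self_concordant_on Q (fin f) \<and>
     (\<forall>z\<in>frontier Q. (f \<longlongrightarrow> \<infinity>) (at z within Q))"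

definition pointed :: "'a::real_vector set \<Rightarrow> bool" where
  "pointed K \<longleftrightarrow> K \<inter> uminus ` K = {0}"

text \<open>\<open>K\<close> is not required to be pointed here, so that the notion also applies to a preimage
  \<open>P -` K\<close> under a linear map with nontrivial kernel; pointedness is a separate hypothesis.\<close>

definition canonical_barrier :: "real \<Rightarrow> 'a::euclidean_space set \<Rightarrow> ('a \<Rightarrow> ereal) \<Rightarrow> bool" where
  "canonical_barrier \<nu> K f \<longleftrightarrow>
     closed K \<and> convex K \<and> cone K \<and> interior K \<noteq> {} \<and>
     self_concordant_barrier (interior K) f \<and>
     (\<forall>x\<in>interior K. \<forall>\<tau>>0. f (\<tau> *\<^sub>R x) = f x - ereal (\<nu> * ln \<tau>))"

subsection \<open>The problem\<close>

text \<open>The maximum defining \<open>\<Omega>\<^sub>g\<close>, as a supremum in the extended reals. If it is finite and \<open>g\<close> is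
  closed, proper and continuous on its domain and \<open>X\<close> is compact, then \<open>edom g \<inter> X\<close> is
  compact and the supremum is attained (if nonempty).\<close>

definition Omega_g :: "('e \<Rightarrow> ereal) \<Rightarrow> 'e set \<Rightarrow> ereal" where
  "Omega_g g X = (SUP (x, y) \<in> (edom g \<inter> X) \<times> (edom g \<inter> X). \<bar>g x - g y\<bar>)"

definition Opt :: "('e \<Rightarrow> ereal) \<Rightarrow> 'e set \<Rightarrow> ('e \<Rightarrow> 'h) \<Rightarrow> 'h set \<Rightarrow> ereal" where
  "Opt g X P K = (INF x \<in> {x \<in> X. P x \<in> K}. g x)"

definition eps_solution ::
  "('e \<Rightarrow> ereal) \<Rightarrow> 'e set \<Rightarrow> ('e \<Rightarrow> 'h) \<Rightarrow> 'h set \<Rightarrow> real \<Rightarrow> 'e \<Rightarrow> bool" where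
  "eps_solution g X P K \<epsilon> z \<longleftrightarrow> z \<in> X \<and> P z \<in> K \<and> g z - Opt g X P K \<le> ereal \<epsilon>"

definition Cset :: "('e \<Rightarrow> ereal) \<Rightarrow> ('e \<Rightarrow> ereal) \<Rightarrow> 'e set \<Rightarrow> 'e set" where
  "Cset F g X = X \<inter> edom F \<inter> edom g"

subsection \<open>Inexact oracle and inner procedure\<close>

text \<open>The value is \<open>-\<infinity>\<close> at points \<open>s\<close> outside the domain of \<open>g\<close>.\<close>

definition Gam :: "('e::euclidean_space \<Rightarrow> ereal) \<Rightarrow> ('e \<Rightarrow> ereal) \<Rightarrow> real \<Rightarrow> 'e \<Rightarrow> 'e \<Rightarrow> ereal" where
  "Gam F g t x s = ereal (dir1 (fin F) x (x - s) / t) + g x - g s"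

definition Gap :: "('e::euclidean_space \<Rightarrow> ereal) \<Rightarrow> ('e \<Rightarrow> ereal) \<Rightarrow> 'e set \<Rightarrow> real \<Rightarrow> 'e \<Rightarrow> ereal" where
  "Gap F g X t x = (SUP s \<in> X. Gam F g t x s)"

definition inexact_lmo ::
  "('e::euclidean_space \<Rightarrow> ereal) \<Rightarrow> ('e \<Rightarrow> ereal) \<Rightarrow> 'e set \<Rightarrow> real \<Rightarrow> real \<Rightarrow> real \<Rightarrow> ('e \<Rightarrow> 'e) \<Rightarrow> bool"
  where
  "inexact_lmo F g X \<delta> \<theta> t s \<longleftrightarrow>
     (\<forall>x\<in>Cset F g X. s x \<in> Cset F g X \<and>
        Gam F g t x (s x) \<ge> ereal \<delta> * (Gap F g X t x - ereal \<theta>))"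

definition gap_tilde ::
  "('e::euclidean_space \<Rightarrow> ereal) \<Rightarrow> ('e \<Rightarrow> ereal) \<Rightarrow> ('e \<Rightarrow> 'e) \<Rightarrow> real \<Rightarrow> 'e \<Rightarrow> real" where
  "gap_tilde F g s t x = real_of_ereal (Gam F g t x (s x))"

definition e_tilde :: "('e::euclidean_space \<Rightarrow> ereal) \<Rightarrow> ('e \<Rightarrow> 'e) \<Rightarrow> 'e \<Rightarrow> real" where
  "e_tilde F s x = sqrt (dir2 (fin F) x (s x - x) (s x - x))"

definition alpha_tilde ::
  "('e::euclidean_space \<Rightarrow> ereal) \<Rightarrow> ('e \<Rightarrow> ereal) \<Rightarrow> ('e \<Rightarrow> 'e) \<Rightarrow> real \<Rightarrow> 'e \<Rightarrow> real" where
  "alpha_tilde F g s t x =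
     (let G = gap_tilde F g s t x; e = e_tilde F s x
      in if e = 0 then 1 else min 1 (t * G / (e * (e + t * G))))"

text \<open>The result \<open>Some (k, x)\<close> consists of the iteration index, which equals the number of
  conditional gradient steps performed, and the point returned; \<open>None\<close> means nontermination.\<close>

definition icg ::
  "('e::euclidean_space \<Rightarrow> ereal) \<Rightarrow> ('e \<Rightarrow> ereal) \<Rightarrow> ('e \<Rightarrow> 'e) \<Rightarrow> real \<Rightarrow> real \<Rightarrow> real \<Rightarrow> 'e
     \<Rightarrow> (nat \<times> 'e) option" where
  "icg F g s t \<eta> \<delta> x0 =
     while_option (\<lambda>(k, x). gap_tilde F g s t x > \<eta> * \<delta>)
       (\<lambda>(k, x). (Suc k, x + alpha_tilde F g s t x *\<^sub>R (s x - x))) (0, x0)"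

subsection \<open>The homotopy\<close>

text \<open>The oracle \<open>s\<close> is indexed by the homotopy parameter \<open>t\<close>. At stage \<open>i\<close> the parameters are
  \<open>t\<^sub>i = t\<^sub>0 / \<sigma>\<^sup>i\<close> and \<open>\<eta>\<^sub>i = \<eta>\<^sub>0 \<sigma>\<^sup>i\<close>. The result for \<open>i\<close> is the total number of
  steps of stages \<open>0, \<dots>, i\<close>, together with the point returned by stage \<open>i\<close>.\<close>

primrec homotopy_stage ::
  "('e::euclidean_space \<Rightarrow> ereal) \<Rightarrow> ('e \<Rightarrow> ereal) \<Rightarrow> (real \<Rightarrow> 'e \<Rightarrow> 'e) \<Rightarrow> real \<Rightarrow> real \<Rightarrow> real \<Rightarrow> real
     \<Rightarrow> 'e \<Rightarrow> nat \<Rightarrow> (nat \<times> 'e) option" where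
  "homotopy_stage F g s t0 \<eta>0 \<sigma> \<delta> x0 0 = icg F g (s t0) t0 \<eta>0 \<delta> x0"
| "homotopy_stage F g s t0 \<eta>0 \<sigma> \<delta> x0 (Suc i) =
     do {
       (n, x) \<leftarrow> homotopy_stage F g s t0 \<eta>0 \<sigma> \<delta> x0 i;
       (k, z) \<leftarrow> icg F g (s (t0 / \<sigma> ^ Suc i)) (t0 / \<sigma> ^ Suc i) (\<eta>0 * \<sigma> ^ Suc i) \<delta> x;
       Some (n + k, z)
     }"

text \<open>The index \<open>I\<close> of the last stage; it is \<open>0\<close> if \<open>\<epsilon> \<ge> 3 \<eta>\<^sub>0\<close>.\<close>

definition last_stage :: "real \<Rightarrow> real \<Rightarrow> real \<Rightarrow> nat" where
  "last_stage \<eta>0 \<sigma> \<epsilon> = nat \<lceil>ln (3 * \<eta>0 / \<epsilon>) / ln (1 / \<sigma>)\<rceil>"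

definition inexact_homotopy ::
  "('e::euclidean_space \<Rightarrow> ereal) \<Rightarrow> ('e \<Rightarrow> ereal) \<Rightarrow> (real \<Rightarrow> 'e \<Rightarrow> 'e) \<Rightarrow> real \<Rightarrow> real \<Rightarrow> real \<Rightarrow> real
     \<Rightarrow> 'e \<Rightarrow> real \<Rightarrow> (nat \<times> 'e) option" where
  "inexact_homotopy F g s t0 \<eta>0 \<sigma> \<delta> x0 \<epsilon> =
     homotopy_stage F g s t0 \<eta>0 \<sigma> \<delta> x0 (last_stage \<eta>0 \<sigma> \<epsilon>)"

text \<open>Only the oracles actually called at accuracy \<open>\<epsilon>\<close>, those of the stages
  \<open>0, \<dots>, I\<close>, are constrained.\<close>

definition homotopy_oracle ::
  "('e::euclidean_space \<Rightarrow> ereal) \<Rightarrow> ('e \<Rightarrow> ereal) \<Rightarrow> 'e set \<Rightarrow> real \<Rightarrow> real \<Rightarrow> real \<Rightarrow> real \<Rightarrow> real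
     \<Rightarrow> real \<Rightarrow> (real \<Rightarrow> 'e \<Rightarrow> 'e) \<Rightarrow> bool" where
  "homotopy_oracle F g X t0 \<eta>0 \<theta>0 \<sigma> \<delta> \<epsilon> s \<longleftrightarrow>
     (\<forall>i \<le> last_stage \<eta>0 \<sigma> \<epsilon>.
        inexact_lmo F g X \<delta> (\<theta>0 * \<sigma> ^ i) (t0 / \<sigma> ^ i) (s (t0 / \<sigma> ^ i)))"

text \<open>Total number of conditional gradient steps; only meaningful if the run terminates.\<close>

definition Compl ::
  "('e::euclidean_space \<Rightarrow> ereal) \<Rightarrow> ('e \<Rightarrow> ereal) \<Rightarrow> (real \<Rightarrow> 'e \<Rightarrow> 'e) \<Rightarrow> real \<Rightarrow> real \<Rightarrow> real \<Rightarrow> real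
     \<Rightarrow> 'e \<Rightarrow> real \<Rightarrow> nat" where
  "Compl F g s t0 \<eta>0 \<sigma> \<delta> x0 \<epsilon> = fst (the (inexact_homotopy F g s t0 \<eta>0 \<sigma> \<delta> x0 \<epsilon>))"

end

theory Submission
  imports Defs
begin

text \<open>At stage \<open>i\<close> the potential \<open>F + t g\<close> decreases in every conditional gradient step by at least
  half the step length times \<open>t\<close> times the oracle gap: the step length nearly minimizes the quadratic-type upper
  bound that self-concordance gives along the search direction. Logarithmic homogeneity bounds the local
  norm of the search direction by a multiple of \<open>\<nu> + t \<Omega>\<close> plus \<open>t\<close> times the gap, and since
  \<open>t \<eta> = 2 \<nu>\<close> at all stages, the decrease is at least a constant times \<open>1 / t\<^sup>2\<close>. When a stage stops,
  the gap bounds the initial potential gap of the next stage by a constant independent of \<open>i\<close>. So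
  stage \<open>i\<close> takes \<open>O(t\<^sup>2) = O(1 / \<sigma> ^ (2 * i))\<close> steps, a geometric sum dominated by its last term,
  where \<open>1 / \<sigma> ^ i\<close> is of order \<open>\<Omega> / \<epsilon>\<close>. The final accuracy is the sum of the gap
  \<open>2 \<eta>\<close> and of \<open>\<nu> / t = \<eta> / 2\<close>, which is at most \<open>3 \<eta>\<close>.\<close>

subsection \<open>Self-concordance along a line\<close>

text \<open>The Lipschitz bound for \<open>1 / sqrt y\<close> with denominators cleared, a form that
  keeps its meaning where \<open>y\<close> vanishes. Later \<open>y\<close> is the second derivative
  of a barrier along a line.\<close>

lemma self_concordant_sqrt_bound:
  fixes y y' :: "real \<Rightarrow> real"
  assumes b: "0 \<le> b"
    and deriv: "\<And>\<tau>. 0 \<le> \<tau> \<Longrightarrow> \<tau> \<le> b \<Longrightarrow> (y has_real_derivative y' \<tau>) (at \<tau>)"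
    and nonneg: "\<And>\<tau>. 0 \<le> \<tau> \<Longrightarrow> \<tau> \<le> b \<Longrightarrow> 0 \<le> y \<tau>"
    and bound: "\<And>\<tau>. 0 \<le> \<tau> \<Longrightarrow> \<tau> \<le> b \<Longrightarrow> \<bar>y' \<tau>\<bar> \<le> 2 * y \<tau> powr (3 / 2)"
  shows "\<bar>sqrt (y b) - sqrt (y 0)\<bar> \<le> b * sqrt (y b) * sqrt (y 0)"
proof -
  text \<open>Since \<open>1 / sqrt y\<close> is \<open>1\<close>-Lipschitz wherever \<open>y\<close> is positive, and \<open>y\<close> may vanish,
    the argument is applied to \<open>y + \<kappa>\<close>.\<close>
  have perturbed: "\<bar>sqrt (y b + \<kappa>) - sqrt (y 0 + \<kappa>)\<bar> \<le> b * sqrt (y b + \<kappa>) * sqrt (y 0 + \<kappa>)"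
    if \<kappa>: "\<kappa> > 0" for \<kappa>
  proof -
    define w where "w \<tau> = 1 / sqrt (y \<tau> + \<kappa>)" for \<tau>
    define w' where "w' \<tau> = - y' \<tau> / (2 * sqrt (y \<tau> + \<kappa>) ^ 3)" for \<tau>
    have "norm (w b - w 0) \<le> 1 * norm (b - 0)"
    proof (rule field_differentiable_bound[of "{0..b}" w w'])
      fix \<tau> assume "\<tau> \<in> {0..b}"
      then have \<tau>: "0 \<le> \<tau>" "\<tau> \<le> b" by auto
      have pos: "y \<tau> + \<kappa> > 0" using nonneg[OF \<tau>] \<kappa> by simp
      then have spos: "sqrt (y \<tau> + \<kappa>) > 0" by simp
      have "(w has_real_derivative w' \<tau>) (at \<tau>)"
        unfolding w_def w'_def using pos spos
        by (auto intro!: derivative_eq_intros deriv[OF \<tau>] simp: field_simps power2_eq_square power3_eq_cube)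
      then show "(w has_real_derivative w' \<tau>) (at \<tau> within {0..b})"
        by (rule has_field_derivative_at_within)
      have "y \<tau> powr (3 / 2) = sqrt (y \<tau>) ^ 3"
        using nonneg[OF \<tau>]
        by (cases "y \<tau> = 0") (simp_all add: powr_half_sqrt[symmetric] powr_powr flip: powr_numeral)
      also have "\<dots> \<le> sqrt (y \<tau> + \<kappa>) ^ 3"
        using nonneg[OF \<tau>] \<kappa> by (intro power_mono) auto
      finally show "norm (w' \<tau>) \<le> 1"
        using bound[OF \<tau>] spos by (simp add: w'_def divide_simps abs_mult)
    qed (use b in auto)
    moreover have "y b + \<kappa> > 0" "y 0 + \<kappa> > 0"
      using nonneg[of b] nonneg[of 0] b \<kappa> by auto
    ultimately show ?thesis
      using b by (simp add: w_def abs_le_iff divide_simps mult_ac split: if_splits)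
  qed
  show ?thesis
  proof (rule tendsto_le)
    show "((\<lambda>\<kappa>. b * sqrt (y b + \<kappa>) * sqrt (y 0 + \<kappa>)) \<longlongrightarrow> b * sqrt (y b) * sqrt (y 0)) (at_right 0)"
      by (rule tendsto_eq_intros refl | simp)+
    show "((\<lambda>\<kappa>. \<bar>sqrt (y b + \<kappa>) - sqrt (y 0 + \<kappa>)\<bar>) \<longlongrightarrow> \<bar>sqrt (y b) - sqrt (y 0)\<bar>) (at_right 0)"
      by (rule tendsto_eq_intros refl | simp)+
    show "\<forall>\<^sub>F \<kappa> in at_right 0. \<bar>sqrt (y b + \<kappa>) - sqrt (y 0 + \<kappa>)\<bar> \<le> b * sqrt (y b + \<kappa>) * sqrt (y 0 + \<kappa>)"
      using perturbed by (auto simp: eventually_at_filter)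
  qed simp
qed

text \<open>Self-concordance limits the growth of the curvature, and integrating twice gives a
  Taylor bound. Its remainder is a rational function of \<open>a * e\<close> that fits the step
  length formula, as \<open>step_length_decrease\<close> shows.\<close>

lemma self_concordant_upper:
  fixes \<phi> \<phi>1 \<phi>2 \<phi>3 :: "real \<Rightarrow> real"
  assumes a: "0 \<le> a"
    and d0: "\<And>\<tau>. 0 \<le> \<tau> \<Longrightarrow> \<tau> \<le> a \<Longrightarrow> (\<phi> has_real_derivative \<phi>1 \<tau>) (at \<tau>)"
    and d1: "\<And>\<tau>. 0 \<le> \<tau> \<Longrightarrow> \<tau> \<le> a \<Longrightarrow> (\<phi>1 has_real_derivative \<phi>2 \<tau>) (at \<tau>)"
    and d2: "\<And>\<tau>. 0 \<le> \<tau> \<Longrightarrow> \<tau> \<le> a \<Longrightarrow> (\<phi>2 has_real_derivative \<phi>3 \<tau>) (at \<tau>)"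
    and nonneg: "\<And>\<tau>. 0 \<le> \<tau> \<Longrightarrow> \<tau> \<le> a \<Longrightarrow> 0 \<le> \<phi>2 \<tau>"
    and sc: "\<And>\<tau>. 0 \<le> \<tau> \<Longrightarrow> \<tau> \<le> a \<Longrightarrow> \<bar>\<phi>3 \<tau>\<bar> \<le> 2 * \<phi>2 \<tau> powr (3 / 2)"
    and e: "e = sqrt (\<phi>2 0)" and small: "a * e < 1"
  shows "\<phi> a \<le> \<phi> 0 + a * \<phi>1 0 + (a * e)\<^sup>2 / (2 * (1 - a * e))"
proof -
  have e0: "e \<ge> 0" using e nonneg[of 0] a by simp
  have le1: "\<tau> * e < 1" if "\<tau> \<le> a" for \<tau>
    using mult_right_mono[OF that e0] small by linarith
  have \<phi>2_le: "\<phi>2 \<tau> \<le> (e / (1 - \<tau> * e))\<^sup>2" if \<tau>: "0 \<le> \<tau>" "\<tau> \<le> a" for \<tau>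
  proof -
    have "\<bar>sqrt (\<phi>2 \<tau>) - sqrt (\<phi>2 0)\<bar> \<le> \<tau> * sqrt (\<phi>2 \<tau>) * sqrt (\<phi>2 0)"
      by (rule self_concordant_sqrt_bound[OF \<tau>(1), of \<phi>2 \<phi>3]) (use d2 nonneg sc \<tau> in auto)
    then have "sqrt (\<phi>2 \<tau>) * (1 - \<tau> * e) \<le> e" by (simp add: e abs_le_iff algebra_simps)
    then have "sqrt (\<phi>2 \<tau>) \<le> e / (1 - \<tau> * e)" using le1[OF \<tau>(2)] by (simp add: pos_le_divide_eq)
    then have "sqrt (\<phi>2 \<tau>) ^ 2 \<le> (e / (1 - \<tau> * e)) ^ 2"
      using nonneg[OF \<tau>] by (intro power_mono) auto
    then show ?thesis using nonneg[OF \<tau>] by simp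
  qed
  text \<open>A comparison function with second derivative \<open>e\<^sup>2 / (1 - \<tau> e)\<^sup>3\<close>, which avoids the
    logarithm of the exact integral of \<open>(e / (1 - \<tau> e))\<^sup>2\<close>.\<close>
  define h where "h \<tau> = (inverse (1 - \<tau> * e) + (1 - \<tau> * e)) / 2 - 1" for \<tau>
  define h1 where "h1 \<tau> = (e * inverse (1 - \<tau> * e) ^ 2 - e) / 2" for \<tau>
  define h2 where "h2 \<tau> = e\<^sup>2 * inverse (1 - \<tau> * e) ^ 3" for \<tau>
  have dh: "(h has_real_derivative h1 \<tau>) (at \<tau>)" if "\<tau> \<le> a" for \<tau>
    unfolding h_def h1_def using le1[OF that]
    by (auto intro!: derivative_eq_intros simp: power2_eq_square)
  have dh1: "(h1 has_real_derivative h2 \<tau>) (at \<tau>)" if "\<tau> \<le> a" for \<tau>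
    unfolding h1_def h2_def using le1[OF that]
    by (auto intro!: derivative_eq_intros simp: power2_eq_square power3_eq_cube)
  have \<phi>2_le': "\<phi>2 \<tau> \<le> h2 \<tau>" if \<tau>: "0 \<le> \<tau>" "\<tau> \<le> a" for \<tau>
  proof -
    have p: "0 < 1 - \<tau> * e" "1 - \<tau> * e \<le> 1" using le1[OF \<tau>(2)] \<tau> e0 by auto
    then have "inverse (1 - \<tau> * e) ^ 2 \<le> inverse (1 - \<tau> * e) ^ 3"
      by (intro power_increasing) (auto simp: one_le_inverse_iff)
    then have "(e / (1 - \<tau> * e))\<^sup>2 \<le> h2 \<tau>"
      unfolding h2_def by (simp add: divide_inverse power_mult_distrib mult_left_mono)
    with \<phi>2_le[OF \<tau>] show ?thesis by simp
  qed
  \<comment> \<open>\<open>h\<close> and \<open>h1\<close> vanish at 0, so comparing derivatives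
    bounds first the slope and then the value.\<close>
  have \<phi>1_le: "\<phi>1 \<tau> \<le> \<phi>1 0 + h1 \<tau>" if \<tau>: "0 \<le> \<tau>" "\<tau> \<le> a" for \<tau>
  proof -
    have "\<phi>1 \<tau> - h1 \<tau> \<le> \<phi>1 0 - h1 0"
    proof (rule DERIV_nonpos_imp_nonincreasing[OF \<tau>(1), of "\<lambda>\<tau>. \<phi>1 \<tau> - h1 \<tau>"])
      fix x assume x: "0 \<le> x" "x \<le> \<tau>"
      then show "\<exists>y. ((\<lambda>\<tau>. \<phi>1 \<tau> - h1 \<tau>) has_real_derivative y) (at x) \<and> y \<le> 0"
        using \<tau> \<phi>2_le'[of x] by (intro exI[of _ "\<phi>2 x - h2 x"] conjI DERIV_diff d1 dh1) auto
    qed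
    then show ?thesis by (simp add: h1_def)
  qed
  have "\<phi> a - \<phi>1 0 * a - h a \<le> \<phi> 0 - \<phi>1 0 * 0 - h 0"
  proof (rule DERIV_nonpos_imp_nonincreasing[OF a, of "\<lambda>\<tau>. \<phi> \<tau> - \<phi>1 0 * \<tau> - h \<tau>"])
    fix x assume x: "0 \<le> x" "x \<le> a"
    then show "\<exists>y. ((\<lambda>\<tau>. \<phi> \<tau> - \<phi>1 0 * \<tau> - h \<tau>) has_real_derivative y) (at x) \<and> y \<le> 0"
      using \<phi>1_le[OF x]
      by (intro exI[of _ "\<phi>1 x - \<phi>1 0 - h1 x"]) (auto intro!: derivative_eq_intros d0 dh)
  qed
  moreover have "h a = (a * e)\<^sup>2 / (2 * (1 - a * e))"
    using small by (simp add: h_def field_simps power2_eq_square)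
  moreover have "h 0 = 0" by (simp add: h_def)
  ultimately show ?thesis by (simp add: mult.commute[of "\<phi>1 0"])
qed

text \<open>With \<open>e = sqrt (\<phi>2 0)\<close> the curvature is at least
  \<open>(e / (1 + \<tau> * e)) ^ 2\<close>, which integrates to \<open>e\<close> over the
  half-line. A slope that never becomes positive must start at \<open>- e\<close> or below.\<close>

lemma self_concordant_lower:
  fixes \<phi>1 \<phi>2 \<phi>3 :: "real \<Rightarrow> real"
  assumes d1: "\<And>\<tau>. 0 \<le> \<tau> \<Longrightarrow> (\<phi>1 has_real_derivative \<phi>2 \<tau>) (at \<tau>)"
    and d2: "\<And>\<tau>. 0 \<le> \<tau> \<Longrightarrow> (\<phi>2 has_real_derivative \<phi>3 \<tau>) (at \<tau>)"
    and nonneg: "\<And>\<tau>. 0 \<le> \<tau> \<Longrightarrow> 0 \<le> \<phi>2 \<tau>"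
    and sc: "\<And>\<tau>. 0 \<le> \<tau> \<Longrightarrow> \<bar>\<phi>3 \<tau>\<bar> \<le> 2 * \<phi>2 \<tau> powr (3 / 2)"
    and nonpos: "\<And>\<tau>. 0 \<le> \<tau> \<Longrightarrow> \<phi>1 \<tau> \<le> 0"
  shows "sqrt (\<phi>2 0) \<le> - \<phi>1 0"
proof (cases "\<phi>2 0 = 0")
  case True
  then show ?thesis using nonpos[of 0] by simp
next
  case False
  define e where "e = sqrt (\<phi>2 0)"
  have e: "e > 0" using False nonneg[of 0] by (simp add: e_def)
  have \<phi>2_ge: "(e / (1 + \<tau> * e))\<^sup>2 \<le> \<phi>2 \<tau>" if \<tau>: "0 \<le> \<tau>" for \<tau>
  proof -
    have "\<bar>sqrt (\<phi>2 \<tau>) - sqrt (\<phi>2 0)\<bar> \<le> \<tau> * sqrt (\<phi>2 \<tau>) * sqrt (\<phi>2 0)"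
      by (rule self_concordant_sqrt_bound[OF \<tau>, of \<phi>2 \<phi>3]) (use d2 nonneg sc \<tau> in auto)
    then have *: "e \<le> sqrt (\<phi>2 \<tau>) * (1 + \<tau> * e)" by (simp add: e_def abs_le_iff algebra_simps)
    have "1 + \<tau> * e > 0" using e \<tau> by (simp add: add_pos_nonneg)
    with * have "e / (1 + \<tau> * e) \<le> sqrt (\<phi>2 \<tau>)" by (simp add: pos_divide_le_eq)
    then have "(e / (1 + \<tau> * e)) ^ 2 \<le> sqrt (\<phi>2 \<tau>) ^ 2"
      using e \<tau> by (intro power_mono) auto
    then show ?thesis using nonneg[OF \<tau>] by simp
  qed
  have *: "e - e / (1 + \<tau> * e) \<le> - \<phi>1 0" if \<tau>: "0 \<le> \<tau>" for \<tau>
  proof -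
    have "\<phi>1 0 + e / (1 + 0 * e) \<le> \<phi>1 \<tau> + e / (1 + \<tau> * e)"
    proof (rule DERIV_nonneg_imp_nondecreasing[OF \<tau>, of "\<lambda>\<tau>. \<phi>1 \<tau> + e / (1 + \<tau> * e)"])
      fix x :: real assume x: "0 \<le> x" "x \<le> \<tau>"
      have "1 + x * e > 0" using e x by (simp add: add_pos_nonneg)
      then have "((\<lambda>\<tau>. \<phi>1 \<tau> + e / (1 + \<tau> * e)) has_real_derivative \<phi>2 x - (e / (1 + x * e))\<^sup>2) (at x)"
        by (auto intro!: derivative_eq_intros d1[OF x(1)] simp: power2_eq_square)
      then show "\<exists>y. ((\<lambda>\<tau>. \<phi>1 \<tau> + e / (1 + \<tau> * e)) has_real_derivative y) (at x) \<and> 0 \<le> y"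
        using \<phi>2_ge[OF x(1)] by (intro exI[of _ "\<phi>2 x - (e / (1 + x * e))\<^sup>2"]) auto
    qed
    with nonpos[OF \<tau>] show ?thesis by simp
  qed
  have "filterlim (\<lambda>\<tau>. 1 + \<tau> * e) at_top at_top"
    by (intro filterlim_tendsto_add_at_top[OF tendsto_const] filterlim_at_top_mult_tendsto_pos[OF tendsto_const e] filterlim_ident)
  then have "((\<lambda>\<tau>. e / (1 + \<tau> * e)) \<longlongrightarrow> 0) at_top"
    by (intro real_tendsto_divide_at_top[OF tendsto_const])
  then have "((\<lambda>\<tau>. e - e / (1 + \<tau> * e)) \<longlongrightarrow> e - 0) at_top"
    by (intro tendsto_diff tendsto_const)
  moreover have "\<forall>\<^sub>F \<tau> in at_top. e - e / (1 + \<tau> * e) \<le> - \<phi>1 0"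
    using eventually_ge_at_top[of 0] by eventually_elim (rule *)
  ultimately have "e - 0 \<le> - \<phi>1 0" by (rule tendsto_upperbound) simp
  then show ?thesis by (simp add: e_def)
qed

subsection \<open>Logarithmically homogeneous self-concordant functions\<close>

lemma dir1_line:
  fixes f :: "'a::euclidean_space \<Rightarrow> real"
  assumes "f differentiable (at (x + \<tau> *\<^sub>R d))"
  shows "((\<lambda>\<tau>. f (x + \<tau> *\<^sub>R d)) has_real_derivative dir1 f (x + \<tau> *\<^sub>R d) d) (at \<tau>)"
proof -
  let ?D = "frechet_derivative f (at (x + \<tau> *\<^sub>R d))"
  have D: "(f has_derivative ?D) (at (x + \<tau> *\<^sub>R d))"
    using assms frechet_derivative_works by blast
  have "((\<lambda>\<tau>. x + \<tau> *\<^sub>R d) has_derivative (\<lambda>r. r *\<^sub>R d)) (at \<tau>)"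
    by (auto intro!: derivative_eq_intros)
  from has_derivative_compose[OF this D]
  have "((\<lambda>\<tau>. f (x + \<tau> *\<^sub>R d)) has_derivative (\<lambda>r. ?D (r *\<^sub>R d))) (at \<tau>)" .
  moreover have "?D (r *\<^sub>R d) = dir1 f (x + \<tau> *\<^sub>R d) d * r" for r
    using linear_cmul[OF linear_frechet_derivative[OF assms]] by (simp add: dir1_def)
  ultimately show ?thesis by (simp add: has_field_derivative_def)
qed

locale self_concordant =
  fixes Q :: "'a::euclidean_space set" and \<Phi> :: "'a \<Rightarrow> real"
  assumes sc: "self_concordant_on Q \<Phi>"
begin

lemma open_Q: "open Q" and convex_Q: "convex Q" and convex_\<Phi>: "convex_on Q \<Phi>"
  using sc by (auto simp: self_concordant_on_def)

lemma
  assumes "x \<in> Q"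
  shows diff0: "\<Phi> differentiable (at x)"
    and diff1: "(\<lambda>y. dir1 \<Phi> y h1) differentiable (at x)"
    and diff2: "(\<lambda>y. dir2 \<Phi> y h1 h2) differentiable (at x)"
proof -
  have "Ck_on (Suc (Suc (Suc 0))) \<Phi> Q"
    using sc by (simp add: self_concordant_on_def numeral_3_eq_3)
  then show "\<Phi> differentiable (at x)" "(\<lambda>y. dir1 \<Phi> y h1) differentiable (at x)"
    "(\<lambda>y. dir2 \<Phi> y h1 h2) differentiable (at x)"
    using assms by (auto simp: dir2_def)
qed

lemma linear_dir1: "x \<in> Q \<Longrightarrow> linear (dir1 \<Phi> x)"
  using linear_frechet_derivative[OF diff0] by (simp add: dir1_def[abs_def])

lemma dir1_scale: "x \<in> Q \<Longrightarrow> dir1 \<Phi> x (c *\<^sub>R h) = c * dir1 \<Phi> x h"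
  and dir1_add: "x \<in> Q \<Longrightarrow> dir1 \<Phi> x (h + h') = dir1 \<Phi> x h + dir1 \<Phi> x h'"
  and dir1_diff: "x \<in> Q \<Longrightarrow> dir1 \<Phi> x (h - h') = dir1 \<Phi> x h - dir1 \<Phi> x h'"
  using linear_dir1[of x] by (simp_all add: linear_cmul linear_add linear_diff)

lemma line_deriv:
  assumes "x + \<tau> *\<^sub>R d \<in> Q"
  shows "((\<lambda>\<tau>. \<Phi> (x + \<tau> *\<^sub>R d)) has_real_derivative dir1 \<Phi> (x + \<tau> *\<^sub>R d) d) (at \<tau>)"
    and "((\<lambda>\<tau>. dir1 \<Phi> (x + \<tau> *\<^sub>R d) d) has_real_derivative dir2 \<Phi> (x + \<tau> *\<^sub>R d) d d) (at \<tau>)"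
    and "((\<lambda>\<tau>. dir2 \<Phi> (x + \<tau> *\<^sub>R d) d d) has_real_derivative dir3 \<Phi> (x + \<tau> *\<^sub>R d) d d d) (at \<tau>)"
  using dir1_line[OF diff0[OF assms]] dir1_line[OF diff1[OF assms, of d]]
    dir1_line[OF diff2[OF assms, of d d]]
  by (simp_all add: dir2_def dir3_def)

text \<open>The derivative is the limit of secant slopes from the right, which convexity bounds by
  the slope of the full chord.\<close>

lemma tangent:
  assumes x: "x \<in> Q" and z: "z \<in> Q"
  shows "\<Phi> x + dir1 \<Phi> x (z - x) \<le> \<Phi> z"
proof -
  have "((\<lambda>\<tau>. \<Phi> (x + \<tau> *\<^sub>R (z - x))) has_real_derivative dir1 \<Phi> x (z - x)) (at 0)"
    using line_deriv(1)[of x 0 "z - x"] x by simp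
  then have "((\<lambda>\<tau>. (\<Phi> (x + \<tau> *\<^sub>R (z - x)) - \<Phi> x) / \<tau>) \<longlongrightarrow> dir1 \<Phi> x (z - x)) (at_right 0)"
    unfolding DERIV_def by (simp add: filterlim_at_split)
  moreover have "\<forall>\<^sub>F \<tau> in at_right 0. (\<Phi> (x + \<tau> *\<^sub>R (z - x)) - \<Phi> x) / \<tau> \<le> \<Phi> z - \<Phi> x"
    unfolding eventually_at_right_field
  proof (intro exI[of _ 1] conjI allI impI)
    fix \<tau> :: real assume \<tau>: "0 < \<tau>" "\<tau> < 1"
    have "\<Phi> ((1 - \<tau>) *\<^sub>R x + \<tau> *\<^sub>R z) \<le> (1 - \<tau>) * \<Phi> x + \<tau> * \<Phi> z"
      using \<tau> by (intro convex_onD[OF convex_\<Phi>] x z) auto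
    moreover have "(1 - \<tau>) *\<^sub>R x + \<tau> *\<^sub>R z = x + \<tau> *\<^sub>R (z - x)" by (simp add: algebra_simps)
    ultimately show "(\<Phi> (x + \<tau> *\<^sub>R (z - x)) - \<Phi> x) / \<tau> \<le> \<Phi> z - \<Phi> x"
      using \<tau> by (simp add: divide_simps algebra_simps)
  qed simp
  ultimately have "dir1 \<Phi> x (z - x) \<le> \<Phi> z - \<Phi> x" by (rule tendsto_upperbound) simp
  then show ?thesis by simp
qed

text \<open>Adding the tangent inequalities at two points of a line shows that the slope along the
  line is monotone.\<close>

lemma dir2_nonneg:
  assumes x: "x \<in> Q"
  shows "0 \<le> dir2 \<Phi> x h h"
proof -
  define A where "A = (\<lambda>\<tau>. x + \<tau> *\<^sub>R h) -` Q"
  have A: "open A" "0 \<in> A"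
    unfolding A_def using x by (auto intro!: open_vimage open_Q continuous_intros)
  have "mono_on A (\<lambda>\<tau>. dir1 \<Phi> (x + \<tau> *\<^sub>R h) h)"
  proof (rule mono_onI)
    fix a b :: real assume ab: "a \<in> A" "b \<in> A" "a \<le> b"
    let ?a = "x + a *\<^sub>R h" and ?b = "x + b *\<^sub>R h"
    have in_Q: "?a \<in> Q" "?b \<in> Q" using ab by (auto simp: A_def)
    have eq: "?b - ?a = (b - a) *\<^sub>R h" "?a - ?b = (a - b) *\<^sub>R h" by (simp_all add: algebra_simps)
    have "0 \<le> (b - a) * (dir1 \<Phi> ?b h - dir1 \<Phi> ?a h)"
      using tangent[OF in_Q] tangent[OF in_Q(2,1)]
      unfolding eq dir1_scale[OF in_Q(1)] dir1_scale[OF in_Q(2)] by (simp add: algebra_simps)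
    then show "dir1 \<Phi> ?a h \<le> dir1 \<Phi> ?b h"
      using ab by (cases "a = b") (auto simp: zero_le_mult_iff)
  qed
  from mono_on_imp_deriv_nonneg[OF this line_deriv(2)[of x 0 h]] show ?thesis
    using A x by (simp add: interior_open)
qed

lemma dir3_bound: "x \<in> Q \<Longrightarrow> \<bar>dir3 \<Phi> x h h h\<bar> \<le> 2 * dir2 \<Phi> x h h powr (3 / 2)"
  using sc by (auto simp: self_concordant_on_def)

text \<open>Parallelogram law for the Hessian form. It serves as a triangle inequality, up to a
  constant, in \<open>local_norm_diff_le\<close>.\<close>

lemma dir2_add_diff:
  assumes x: "x \<in> Q"
  shows "dir2 \<Phi> x (h + h') (h + h') + dir2 \<Phi> x (h - h') (h - h')
    = 2 * dir2 \<Phi> x h h + 2 * dir2 \<Phi> x h' h'"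
proof -
  have "dir2 \<Phi> x (h + c *\<^sub>R h') v = dir2 \<Phi> x h v + c * dir2 \<Phi> x h' v" for c v
  proof -
    have D: "((\<lambda>y. dir1 \<Phi> y k) has_derivative dir2 \<Phi> x k) (at x)" for k
      using diff1[OF x, of k] unfolding frechet_derivative_works
      by (simp add: dir2_def[abs_def] dir1_def[abs_def])
    have "((\<lambda>y. dir1 \<Phi> y h + c * dir1 \<Phi> y h') has_derivative
        (\<lambda>v. dir2 \<Phi> x h v + c * dir2 \<Phi> x h' v)) (at x)"
      by (intro derivative_intros D)
    \<comment> \<open>Linearity of \<open>dir1 \<Phi> y\<close> is available for \<open>y\<close> in
      \<open>Q\<close>, an open neighbourhood of \<open>x\<close>, and may thus be differentiated at
      \<open>x\<close>.\<close>
    then have "((\<lambda>y. dir1 \<Phi> y (h + c *\<^sub>R h')) has_derivative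
        (\<lambda>v. dir2 \<Phi> x h v + c * dir2 \<Phi> x h' v)) (at x)"
      by (rule has_derivative_transform_within_open[OF _ open_Q x]) (simp add: dir1_add dir1_scale)
    from has_derivative_unique[OF this D] show ?thesis by metis
  qed
  from this[of 1] this[of "-1"]
  have left: "dir2 \<Phi> x (h + h') v = dir2 \<Phi> x h v + dir2 \<Phi> x h' v"
    "dir2 \<Phi> x (h - h') v = dir2 \<Phi> x h v - dir2 \<Phi> x h' v" for v by simp_all
  have "linear (dir2 \<Phi> x k)" for k
    using linear_frechet_derivative[OF diff1[OF x, of k]] by (simp add: dir2_def[abs_def] dir1_def[abs_def])
  then show ?thesis by (simp add: left linear_add linear_diff)
qed

lemma descent:
  assumes x: "x \<in> Q" and s: "s \<in> Q" and \<alpha>: "0 \<le> \<alpha>" "\<alpha> \<le> 1"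
    and e: "e = sqrt (dir2 \<Phi> x (s - x) (s - x))" and small: "\<alpha> * e < 1"
  shows "\<Phi> (x + \<alpha> *\<^sub>R (s - x)) \<le> \<Phi> x + \<alpha> * dir1 \<Phi> x (s - x) + (\<alpha> * e)\<^sup>2 / (2 * (1 - \<alpha> * e))"
proof -
  have seg: "x + \<tau> *\<^sub>R (s - x) \<in> Q" if "0 \<le> \<tau>" "\<tau> \<le> \<alpha>" for \<tau>
  proof -
    have "(1 - \<tau>) *\<^sub>R x + \<tau> *\<^sub>R s \<in> Q"
      using that \<alpha> by (intro convexD[OF convex_Q x s]) auto
    then show ?thesis by (simp add: algebra_simps)
  qed
  show ?thesis
    using self_concordant_upper[OF \<alpha>(1) line_deriv(1)[OF seg] line_deriv(2)[OF seg]
      line_deriv(3)[OF seg] dir2_nonneg[OF seg] dir3_bound[OF seg], of e] e small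
    by simp
qed

end

locale log_homogeneous_self_concordant = self_concordant +
  fixes \<nu> :: real
  assumes scale_mem: "x \<in> Q \<Longrightarrow> 0 < \<tau> \<Longrightarrow> \<tau> *\<^sub>R x \<in> Q"
    and log_homogeneous: "x \<in> Q \<Longrightarrow> 0 < \<tau> \<Longrightarrow> \<Phi> (\<tau> *\<^sub>R x) = \<Phi> x - \<nu> * ln \<tau>"
begin

text \<open>The point is twice the midpoint of \<open>x\<close> and
  \<open>\<tau> *\<^sub>R s\<close>. That the entire ray stays in \<open>Q\<close> is what
  \<open>self_concordant_lower\<close> requires.\<close>

lemma add_mem:
  assumes x: "x \<in> Q" and s: "s \<in> Q" and \<tau>: "0 \<le> \<tau>"
  shows "x + \<tau> *\<^sub>R s \<in> Q"
proof (cases "\<tau> = 0")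
  case False
  with \<tau> scale_mem[OF s] have "\<tau> *\<^sub>R s \<in> Q" by simp
  then have "(1/2) *\<^sub>R x + (1/2) *\<^sub>R (\<tau> *\<^sub>R s) \<in> Q" by (intro convexD[OF convex_Q x]) auto
  from scale_mem[OF this, of 2] show ?thesis by (simp add: algebra_simps)
qed (use x in simp)

text \<open>Euler's identity, from differentiating \<open>\<Phi> ((1 + \<tau>) *\<^sub>R x)\<close>
  at \<open>\<tau> = 0\<close>.\<close>

lemma dir1_self:
  assumes x: "x \<in> Q"
  shows "dir1 \<Phi> x x = - \<nu>"
proof -
  have "((\<lambda>\<tau>. \<Phi> x - \<nu> * ln (1 + \<tau>)) has_real_derivative - \<nu>) (at 0)"
    by (auto intro!: derivative_eq_intros)
  then have "((\<lambda>\<tau>. \<Phi> (x + \<tau> *\<^sub>R x)) has_real_derivative - \<nu>) (at 0)"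
  proof (rule has_field_derivative_transform_within_open)
    show "\<Phi> x - \<nu> * ln (1 + \<tau>) = \<Phi> (x + \<tau> *\<^sub>R x)" if "\<tau> \<in> {-1<..}" for \<tau>
      using log_homogeneous[OF x, of "1 + \<tau>"] that by (simp add: algebra_simps)
  qed auto
  moreover have "((\<lambda>\<tau>. \<Phi> (x + \<tau> *\<^sub>R x)) has_real_derivative dir1 \<Phi> x x) (at 0)"
    using line_deriv(1)[of x 0 x] x by simp
  ultimately show ?thesis using DERIV_unique by blast
qed

text \<open>Along the ray through \<open>s\<close> the function decreases only logarithmically, so the slope of its
  affine minorant at \<open>x\<close> in the direction \<open>s\<close> cannot be positive.\<close>

lemma dir1_nonpos:
  assumes x: "x \<in> Q" and s: "s \<in> Q"
  shows "dir1 \<Phi> x s \<le> 0"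
proof -
  have bound: "dir1 \<Phi> x s \<le> (\<Phi> s - \<Phi> x - \<nu>) / c - \<nu> * (ln c / c)" if c: "0 < c" for c
  proof -
    have "\<Phi> x + dir1 \<Phi> x (c *\<^sub>R s - x) \<le> \<Phi> (c *\<^sub>R s)"
      by (intro tangent x scale_mem s c)
    then have "c * dir1 \<Phi> x s \<le> \<Phi> s - \<Phi> x - \<nu> - \<nu> * ln c"
      using x by (simp add: dir1_diff dir1_scale dir1_self log_homogeneous s c)
    then have "dir1 \<Phi> x s \<le> (\<Phi> s - \<Phi> x - \<nu> - \<nu> * ln c) / c"
      using c by (simp add: pos_le_divide_eq mult.commute)
    then show ?thesis by (simp add: diff_divide_distrib)
  qed
  have "((\<lambda>c. (\<Phi> s - \<Phi> x - \<nu>) / c - \<nu> * (ln c / c)) \<longlongrightarrow> 0 - \<nu> * 0) at_top"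
    by (intro tendsto_diff tendsto_mult tendsto_const ln_x_over_x_tendsto_0
        real_tendsto_divide_at_top[OF tendsto_const] filterlim_ident)
  moreover have "\<forall>\<^sub>F c in at_top. dir1 \<Phi> x s \<le> (\<Phi> s - \<Phi> x - \<nu>) / c - \<nu> * (ln c / c)"
    using eventually_gt_at_top[of 0] by eventually_elim (rule bound)
  ultimately have "dir1 \<Phi> x s \<le> 0 - \<nu> * 0" by (rule tendsto_lowerbound) simp
  then show ?thesis by simp
qed

text \<open>By continuity of the linear form. Feasible points on the boundary of the cone, where the
  barrier is infinite, must also be compared with the iterates.\<close>

lemma dir1_nonpos_closure:
  assumes x: "x \<in> Q" and s: "s \<in> closure Q"
  shows "dir1 \<Phi> x s \<le> 0"
proof -
  have "closed {s. dir1 \<Phi> x s \<le> 0}"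
    using linear_continuous_on[of "dir1 \<Phi> x" UNIV] linear_dir1[OF x]
    by (intro closed_Collect_le) (auto simp: linear_conv_bounded_linear)
  then have "closure Q \<subseteq> {s. dir1 \<Phi> x s \<le> 0}"
    using dir1_nonpos[OF x] by (intro closure_minimal) auto
  with s show ?thesis by auto
qed

text \<open>By \<open>dir1_nonpos\<close> the slope of \<Phi> is nonpositive along the whole ray
  from \<open>x\<close> in direction \<open>s\<close>, so \<open>self_concordant_lower\<close>
  applies.\<close>

lemma local_norm_le:
  assumes x: "x \<in> Q" and s: "s \<in> Q"
  shows "sqrt (dir2 \<Phi> x s s) \<le> - dir1 \<Phi> x s"
proof -
  note ray = add_mem[OF x s]
  show ?thesis
    using self_concordant_lower[OF line_deriv(2)[OF ray] line_deriv(3)[OF ray] dir2_nonneg[OF ray]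
      dir3_bound[OF ray] dir1_nonpos[OF ray s]]
    by simp
qed

text \<open>The parallelogram law reduces the claim to the local norms of \<open>s\<close> and of
  \<open>x\<close>. By \<open>local_norm_le\<close> and Euler's identity these sum to at most
  \<open>2 * \<nu> + dir1 \<Phi> x (x - s)\<close>.\<close>

lemma local_norm_diff_le:
  assumes x: "x \<in> Q" and s: "s \<in> Q"
  shows "sqrt (dir2 \<Phi> x (s - x) (s - x)) \<le> 2 * (2 * \<nu> + dir1 \<Phi> x (x - s))"
proof -
  let ?q = "\<lambda>h. dir2 \<Phi> x h h"
  have "?q (s - x) \<le> 2 * ?q s + 2 * ?q x"
    using dir2_add_diff[OF x, of s x] dir2_nonneg[OF x, of "s + x"] by linarith
  also have "\<dots> \<le> (2 * (sqrt (?q s) + sqrt (?q x)))\<^sup>2"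
    using dir2_nonneg[OF x] by (simp add: power2_eq_square algebra_simps)
  finally have "sqrt (?q (s - x)) \<le> 2 * (sqrt (?q s) + sqrt (?q x))"
    using dir2_nonneg[OF x] by (intro real_le_lsqrt) auto
  also have "\<dots> \<le> 2 * (2 * \<nu> + dir1 \<Phi> x (x - s))"
    using local_norm_le[OF x s] local_norm_le[OF x x] by (simp add: dir1_diff dir1_self x)
  finally show ?thesis .
qed

end

subsection \<open>Canonical barriers\<close>

lemma interior_cone_scale:
  fixes K :: "'a::euclidean_space set"
  assumes "cone K" "x \<in> interior K" "0 < \<tau>"
  shows "\<tau> *\<^sub>R x \<in> interior K"
proof -
  have "(*\<^sub>R) \<tau> ` interior K \<subseteq> interior K"
    using assms interior_subset[of K]
    by (intro interior_maximal open_scaling) (auto simp: cone_def)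
  then show ?thesis using assms by auto
qed

lemma canonical_barrier_finite:
  assumes "canonical_barrier \<nu> K F" "x \<in> interior K"
  shows "F x = ereal (fin F x)"
  using assms by (simp add: canonical_barrier_def self_concordant_barrier_def fin_def ereal_real')

lemma canonical_barrier_imp_log_homogeneous:
  assumes "canonical_barrier \<nu> K F"
  shows "log_homogeneous_self_concordant (interior K) (fin F) \<nu>"
proof
  have cone: "cone K" and sc: "self_concordant_barrier (interior K) F"
    and hom: "\<And>x \<tau>. x \<in> interior K \<Longrightarrow> 0 < \<tau> \<Longrightarrow> F (\<tau> *\<^sub>R x) = F x - ereal (\<nu> * ln \<tau>)"
    using assms by (auto simp: canonical_barrier_def)
  show "self_concordant_on (interior K) (fin F)"
    using sc by (simp add: self_concordant_barrier_def)
  fix x :: 'a and \<tau> :: real assume x: "x \<in> interior K" and \<tau>: "0 < \<tau>"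
  show "\<tau> *\<^sub>R x \<in> interior K" by (rule interior_cone_scale[OF cone x \<tau>])
  have "F (\<tau> *\<^sub>R x) = ereal (fin F x - \<nu> * ln \<tau>)"
    using hom[OF x \<tau>] canonical_barrier_finite[OF assms x] by simp
  then show "fin F (\<tau> *\<^sub>R x) = fin F x - \<nu> * ln \<tau>" by (simp add: fin_def)
qed

text \<open>The barrier blows up at the origin, so \<open>- \<nu> * ln \<tau>\<close> is unbounded above as \<open>\<tau>\<close> tends to \<open>0\<close>.\<close>

lemma canonical_barrier_parameter_pos:
  fixes K :: "'a::euclidean_space set"
  assumes K: "pointed K" and f: "canonical_barrier \<nu> K f"
  shows "\<nu> > 0"
proof (rule ccontr)
  assume "\<not> \<nu> > 0"
  have cone: "cone K" and ne: "interior K \<noteq> {}"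
    and lim: "\<And>z. z \<in> frontier (interior K) \<Longrightarrow> (f \<longlongrightarrow> \<infinity>) (at z within interior K)"
    and hom: "\<And>x \<tau>. x \<in> interior K \<Longrightarrow> 0 < \<tau> \<Longrightarrow> f (\<tau> *\<^sub>R x) = f x - ereal (\<nu> * ln \<tau>)"
    using f by (auto simp: canonical_barrier_def self_concordant_barrier_def)
  \<comment> \<open>Otherwise a small nonzero vector and its negative both lie in \<open>K\<close>,
    against pointedness. So the origin is a boundary point, where \<open>f\<close> tends to
    infinity.\<close>
  have zero: "0 \<notin> interior K"
  proof
    assume "0 \<in> interior K"
    then obtain r where r: "r > 0" "ball 0 r \<subseteq> K" by (auto simp: mem_interior)
    obtain b :: 'a where b: "b \<in> Basis" using nonempty_Basis by blast
    define v where "v = (r / 2) *\<^sub>R b"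
    have "v \<in> K" "- v \<in> K" using r b by (auto simp: v_def subset_iff)
    then have "v \<in> K \<inter> uminus ` K" by (auto intro: image_eqI[of v uminus "- v"])
    with K have "v = 0" by (auto simp: pointed_def)
    with r b show False by (auto simp: v_def)
  qed
  obtain x where x: "x \<in> interior K" using ne by blast
  define p where "p n = (1 / real (Suc n)) *\<^sub>R x" for n
  have "p \<longlonglongrightarrow> 0 *\<^sub>R x" unfolding p_def
    by (intro tendsto_scaleR tendsto_const LIMSEQ_Suc lim_1_over_n)
  then have p_lim: "p \<longlonglongrightarrow> 0" by simp
  have p_mem: "p n \<in> interior K" for n
    unfolding p_def by (intro interior_cone_scale[OF cone x]) simp
  have "0 \<in> closure (interior K)"
    using p_lim p_mem closure_sequential by blast
  then have "(f \<longlongrightarrow> \<infinity>) (at 0 within interior K)"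
    using zero by (intro lim) (simp add: frontier_def)
  moreover have "filterlim p (at 0 within interior K) sequentially"
    using p_lim p_mem zero by (auto simp: filterlim_at intro!: always_eventually) (metis p_mem zero)
  ultimately have "(\<lambda>n. f (p n)) \<longlonglongrightarrow> \<infinity>" by (rule filterlim_compose)
  then have "\<forall>\<^sub>F n in sequentially. ereal (fin f x) < f (p n)"
    by (simp add: tendsto_PInfty)
  then obtain n where "ereal (fin f x) < f (p n)" by (auto dest: eventually_happens)
  also have "f (p n) = f x - ereal (\<nu> * ln (1 / real (Suc n)))"
    unfolding p_def by (rule hom[OF x]) simp
  also have "\<dots> = ereal (fin f x + \<nu> * ln (real (Suc n)))"
    by (simp add: canonical_barrier_finite[OF f x] ln_div)
  finally have "0 < \<nu> * ln (real (Suc n))" by simp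
  with \<open>\<not> \<nu> > 0\<close> show False by (simp add: zero_less_mult_iff)
qed

subsection \<open>Progress of one conditional gradient step\<close>

text \<open>Here \<open>u\<close> is \<open>t\<close> times the oracle gap, \<open>e\<close> the
  local norm of the direction, and the remainder eats at most half of the linear decrease
  \<open>\<alpha> * u\<close>. A truncated step has \<open>\<alpha> * e = u / (e + u)\<close>, which
  gives equality; a full step means \<open>e * e \<le> u * (1 - e)\<close>.\<close>

lemma step_length_decrease:
  fixes e u :: real
  assumes e: "0 \<le> e" and u: "0 < u"
    and \<alpha>: "\<alpha> = (if e = 0 then 1 else min 1 (u / (e * (e + u))))"
  shows "0 \<le> \<alpha>" "\<alpha> \<le> 1" "\<alpha> * e < 1" "(\<alpha> * e)\<^sup>2 / (2 * (1 - \<alpha> * e)) \<le> \<alpha> * u / 2"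
proof -
  have "0 \<le> \<alpha> \<and> \<alpha> \<le> 1 \<and> \<alpha> * e < 1 \<and> (\<alpha> * e)\<^sup>2 / (2 * (1 - \<alpha> * e)) \<le> \<alpha> * u / 2"
  proof (cases "e = 0")
    case True
    then show ?thesis using \<alpha> u by simp
  next
    case False
    with e have e: "e > 0" by simp
    show ?thesis
    proof (cases "u / (e * (e + u)) \<ge> 1")
      case True
      then have \<alpha>1: "\<alpha> = 1" using False \<alpha> by simp
      from True have *: "e * (e + u) \<le> u" using e u by (simp add: pos_le_divide_eq)
      then have "e * e \<le> u * (1 - e)" by (simp add: algebra_simps)
      moreover have "0 < e * e" using e by simp
      ultimately have "0 < u * (1 - e)" by linarith
      then have "e < 1" using u by (simp add: zero_less_mult_iff)
      moreover from this have "e * e / (2 * (1 - e)) \<le> u / 2"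
        using \<open>e * e \<le> u * (1 - e)\<close> by (subst pos_divide_le_eq) (auto simp: algebra_simps)
      ultimately show ?thesis by (simp add: \<alpha>1 power2_eq_square)
    next
      case 2: False
      then have \<alpha>2: "\<alpha> = u / (e * (e + u))" using False \<alpha> by simp
      have ae: "\<alpha> * e = u / (e + u)" using e by (simp add: \<alpha>2)
      have "1 - \<alpha> * e = e / (e + u)" unfolding ae using e u by (simp add: field_simps)
      then have "(\<alpha> * e)\<^sup>2 / (2 * (1 - \<alpha> * e)) = \<alpha> * u / 2"
        unfolding \<open>1 - \<alpha> * e = _\<close> unfolding ae \<alpha>2 using e u
        by (simp add: power2_eq_square)
      moreover have "\<alpha> * e < 1" unfolding ae using e u by simp
      ultimately show ?thesis using 2 e u by (simp add: \<alpha>2)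
    qed
  qed
  then show "0 \<le> \<alpha>" "\<alpha> \<le> 1" "\<alpha> * e < 1" "(\<alpha> * e)\<^sup>2 / (2 * (1 - \<alpha> * e)) \<le> \<alpha> * u / 2"
    by auto
qed

text \<open>A full step gains \<open>u / 2\<close>, at least \<open>\<nu> * \<delta>\<close>. A
  shorter one gains \<open>u * u / (2 * e * (e + u))\<close>, where
  \<open>\<delta> * r * e \<le> 5 * u\<close> and \<open>\<delta> * r * (e + u) \<le> 6 * u\<close>;
  hence the constant 60 = 2 * 5 * 6. In the homotopy \<open>r\<close> is
  \<open>\<sigma> ^ i\<close>.\<close>

lemma step_length_decrease_ge:
  fixes e u :: real
  assumes e: "0 \<le> e" and \<nu>: "0 < \<nu>" and \<delta>: "0 < \<delta>" "\<delta> \<le> 1" and r: "0 < r" "r \<le> 1"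
    and u: "2 * \<nu> * \<delta> \<le> u" and e_le: "e \<le> 2 * (2 * \<nu> + \<nu> / r + u)"
    and \<alpha>: "\<alpha> = (if e = 0 then 1 else min 1 (u / (e * (e + u))))"
  shows "min (\<nu> * \<delta>) (\<delta>\<^sup>2 / 60) * r\<^sup>2 \<le> \<alpha> * u / 2"
proof -
  have "0 < \<nu> * \<delta>" using \<nu> \<delta> by simp
  then have u0: "0 < u" using u by linarith
  have r2: "r\<^sup>2 \<le> 1" using r by (simp add: power_le_one)
  have "\<alpha> = 1 \<or> e \<noteq> 0 \<and> \<alpha> = u / (e * (e + u))" unfolding \<alpha> by (auto simp: min_def)
  then show ?thesis
  proof
    assume \<alpha>: "\<alpha> = 1"
    have "min (\<nu> * \<delta>) (\<delta>\<^sup>2 / 60) * r\<^sup>2 \<le> (\<nu> * \<delta>) * 1"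
      using r2 \<open>0 < \<nu> * \<delta>\<close> by (intro mult_mono) auto
    also have "\<dots> \<le> \<alpha> * u / 2" using u \<alpha> by simp
    finally show ?thesis .
  next
    assume *: "e \<noteq> 0 \<and> \<alpha> = u / (e * (e + u))"
    with e have e0: "e > 0" by simp
    have \<delta>r: "0 < \<delta> * r" "\<delta> * r \<le> 1" using \<delta> r by (auto intro: mult_le_one)
    have "\<delta> * r * e \<le> \<delta> * r * (2 * (2 * \<nu> + \<nu> / r + u))"
      using e_le \<delta>r by (intro mult_left_mono) auto
    also have "\<dots> = 4 * (\<nu> * \<delta>) * r + 2 * (\<nu> * \<delta>) + 2 * (\<delta> * r) * u"
      using r by (simp add: field_simps)
    also have "\<dots> \<le> 4 * (\<nu> * \<delta>) * 1 + 2 * (\<nu> * \<delta>) + 2 * 1 * u"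
      using r \<delta>r u0 \<nu> \<delta> by (intro add_mono mult_mono) auto
    also have "\<dots> \<le> 5 * u" using u by linarith
    finally have A: "\<delta> * r * e \<le> 5 * u" .
    moreover have "\<delta> * r * u \<le> 1 * u" using \<delta>r u0 by (intro mult_right_mono) auto
    ultimately have B: "\<delta> * r * (e + u) \<le> 6 * u" by (simp add: distrib_left)
    have "0 \<le> \<delta> * r * (e + u)" using \<delta> r u0 e0 by (intro mult_nonneg_nonneg) auto
    with mult_mono[OF A B] u0 have "(\<delta> * r * e) * (\<delta> * r * (e + u)) \<le> (5 * u) * (6 * u)"
      by simp
    then have "\<delta>\<^sup>2 / 60 * r\<^sup>2 * (e * (e + u)) \<le> u * u / 2"
      by (simp add: power2_eq_square algebra_simps)
    then have "\<delta>\<^sup>2 / 60 * r\<^sup>2 \<le> u * u / 2 / (e * (e + u))"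
      using e0 u0 by (subst pos_le_divide_eq) auto
    also have "\<dots> = \<alpha> * u / 2" using * by simp
    finally have "\<delta>\<^sup>2 / 60 * r\<^sup>2 \<le> \<alpha> * u / 2" .
    moreover have "min (\<nu> * \<delta>) (\<delta>\<^sup>2 / 60) * r\<^sup>2 \<le> \<delta>\<^sup>2 / 60 * r\<^sup>2"
      by (intro mult_right_mono) auto
    ultimately show ?thesis by linarith
  qed
qed

text \<open>A potential bounded below can drop by \<open>d\<close> only finitely often. As the
  counter is part of the state, one invariant relates the number of steps to the total drop.\<close>

lemma while_option_potential:
  fixes W :: "'a \<Rightarrow> real"
  assumes init: "I x0" and d: "0 < d"
    and step: "\<And>x. I x \<Longrightarrow> b x \<Longrightarrow> I (c x) \<and> W (c x) \<le> W x - d"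
    and lower: "\<And>x. I x \<Longrightarrow> L \<le> W x"
  shows "\<exists>k x. while_option (\<lambda>(k, x). b x) (\<lambda>(k, x). (Suc k, c x)) (0, x0) = Some (k, x) \<and>
    I x \<and> \<not> b x \<and> real k * d \<le> W x0 - W x"
proof -
  let ?J = "\<lambda>(k, x). I x \<and> real k * d \<le> W x0 - W x"
  have step': "?J (Suc k, c x)" if "?J (k, x)" "b x" for k x
    using that step[of x] by (auto simp: algebra_simps)
  define \<mu> where "\<mu> = (\<lambda>(k::nat, x). nat \<lceil>(W x - L) / d\<rceil>)"
  have decr: "\<mu> (Suc k, c x) < \<mu> (k, x)" if "?J (k, x)" "b x" for k x
  proof -
    have "I x" "I (c x)" "W (c x) \<le> W x - d" using that step[of x] by auto
    then have "(W (c x) - L) / d \<le> (W x - L - d) / d" "0 \<le> (W (c x) - L) / d"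
      using d lower[of "c x"] by (auto intro!: divide_right_mono)
    moreover have "(W x - L - d) / d = (W x - L) / d - 1" using d by (simp add: diff_divide_distrib)
    ultimately have "(W (c x) - L) / d \<le> (W x - L) / d - 1" "0 \<le> (W (c x) - L) / d" by simp_all
    \<comment> \<open>The new ceiling is nonnegative, so truncation by \<open>nat\<close> does not
      spoil the strict decrease.\<close>
    then have "\<lceil>(W (c x) - L) / d\<rceil> \<le> \<lceil>(W x - L) / d\<rceil> - 1" "0 \<le> \<lceil>(W (c x) - L) / d\<rceil>"
      by linarith+
    moreover from this have "0 < \<lceil>(W x - L) / d\<rceil>" by linarith
    ultimately show ?thesis by (simp only: \<mu>_def prod.case nat_mono_iff)
  qed
  have "\<exists>s. while_option (\<lambda>(k, x). b x) (\<lambda>(k, x). (Suc k, c x)) (0, x0) = Some s"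
    by (rule measure_while_option_Some[where P = ?J and f = \<mu>])
      (use step' decr init in \<open>auto split: prod.splits\<close>)
  then obtain k x where run: "while_option (\<lambda>(k, x). b x) (\<lambda>(k, x). (Suc k, c x)) (0, x0) = Some (k, x)"
    by auto
  have "?J (k, x)"
    by (rule while_option_rule[OF _ run]) (use step' init in \<open>auto split: prod.splits\<close>)
  moreover have "\<not> b x" using while_option_stop[OF run] by simp
  ultimately show ?thesis using run by auto
qed

subsection \<open>The conditional gradient procedure\<close>

text \<open>\<open>Kc\<close> stands for the cone \<open>P -` K\<close>, and \<open>\<Phi>\<close>, \<open>gr\<close> are the real-valued versions of \<open>F\<close>
  and \<open>g\<close>.\<close>

locale barrier_problem =
  fixes g F :: "'e::euclidean_space \<Rightarrow> ereal" and Kc X :: "'e set" and \<nu> \<Omega> :: real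
  assumes proper_g: "proper_fun g" and convex_g: "convex_fun g"
    and Omega: "Omega_g g X = ereal \<Omega>" and Omega_pos: "\<Omega> > 0"
    and barrier: "canonical_barrier \<nu> Kc F" and dom_F: "edom F = interior Kc"
    and convex_X: "convex X" and \<nu>_pos: "\<nu> > 0"
begin

abbreviation "\<Phi> \<equiv> fin F"
abbreviation "gr \<equiv> fin g"
abbreviation "C \<equiv> Cset F g X"

sublocale log_homogeneous_self_concordant "interior Kc" \<Phi> \<nu>
  by (rule canonical_barrier_imp_log_homogeneous[OF barrier])

lemma g_eq: "x \<in> edom g \<Longrightarrow> g x = ereal (gr x)"
  using proper_g by (cases "g x") (auto simp: proper_fun_def edom_def fin_def)

lemma C_D:
  assumes "x \<in> C"
  shows "x \<in> X" "x \<in> interior Kc" "x \<in> edom g"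
  using assms by (auto simp: Cset_def dom_F)

lemma C_I: "x \<in> X \<Longrightarrow> x \<in> interior Kc \<Longrightarrow> x \<in> edom g \<Longrightarrow> x \<in> C"
  by (auto simp: Cset_def dom_F)

lemma g_convex:
  assumes x: "x \<in> edom g" and y: "y \<in> edom g" and \<alpha>: "0 \<le> \<alpha>" "\<alpha> \<le> 1"
  shows "x + \<alpha> *\<^sub>R (y - x) \<in> edom g"
    and "gr (x + \<alpha> *\<^sub>R (y - x)) \<le> gr x + \<alpha> * (gr y - gr x)"
proof -
  have "(1 - \<alpha>) *\<^sub>R (x, gr x) + \<alpha> *\<^sub>R (y, gr y) \<in> epi g"
    using convex_g \<alpha> g_eq[OF x] g_eq[OF y] unfolding convex_fun_def
    by (intro convexD) (auto simp: epi_def)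
  moreover have "(1 - \<alpha>) *\<^sub>R x + \<alpha> *\<^sub>R y = x + \<alpha> *\<^sub>R (y - x)" by (simp add: algebra_simps)
  ultimately have *: "g (x + \<alpha> *\<^sub>R (y - x)) \<le> ereal ((1 - \<alpha>) * gr x + \<alpha> * gr y)"
    by (simp add: epi_def)
  then show dom: "x + \<alpha> *\<^sub>R (y - x) \<in> edom g" by (auto simp: edom_def)
  from *[unfolded g_eq[OF dom] ereal_less_eq]
  show "gr (x + \<alpha> *\<^sub>R (y - x)) \<le> gr x + \<alpha> * (gr y - gr x)"
    by (simp add: algebra_simps)
qed

lemma g_variation:
  assumes "x \<in> edom g" "x \<in> X" "y \<in> edom g" "y \<in> X"
  shows "\<bar>gr x - gr y\<bar> \<le> \<Omega>"
proof -
  have "\<bar>g x - g y\<bar> \<le> Omega_g g X"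
    unfolding Omega_g_def by (rule SUP_upper2[of "(x, y)"]) (use assms in auto)
  then show ?thesis using assms by (simp add: Omega g_eq)
qed

lemma step_mem_C:
  assumes x: "x \<in> C" and y: "y \<in> C" and \<alpha>: "0 \<le> \<alpha>" "\<alpha> \<le> 1"
  shows "x + \<alpha> *\<^sub>R (y - x) \<in> C"
proof (rule C_I)
  have eq: "x + \<alpha> *\<^sub>R (y - x) = (1 - \<alpha>) *\<^sub>R x + \<alpha> *\<^sub>R y" by (simp add: algebra_simps)
  show "x + \<alpha> *\<^sub>R (y - x) \<in> X" "x + \<alpha> *\<^sub>R (y - x) \<in> interior Kc"
    unfolding eq using C_D[OF x] C_D[OF y] \<alpha>
    by (auto intro!: convexD[OF convex_X] convexD[OF convex_Q])
  show "x + \<alpha> *\<^sub>R (y - x) \<in> edom g" using C_D[OF x] C_D[OF y] \<alpha> by (intro g_convex)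
qed

lemma Gam_eq:
  assumes "x \<in> edom g" "y \<in> edom g"
  shows "Gam F g t x y = ereal (dir1 \<Phi> x (x - y) / t + gr x - gr y)"
  using assms by (simp add: Gam_def g_eq)

text \<open>\<open>real_of_ereal\<close> is faithful here: the gap is bounded below by the finite
  value at the oracle's point, and above by the oracle inequality because
  \<open>\<delta> > 0\<close>.\<close>

lemma oracle_gap:
  assumes lmo: "inexact_lmo F g X \<delta> \<theta> t s" and \<delta>: "0 < \<delta>" and x: "x \<in> C"
  shows "real_of_ereal (Gap F g X t x) \<le> gap_tilde F g s t x / \<delta> + \<theta>"
    and "\<And>y. y \<in> X \<Longrightarrow> y \<in> edom g \<Longrightarrow>
      dir1 \<Phi> x (x - y) / t + gr x - gr y \<le> real_of_ereal (Gap F g X t x)"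
proof -
  have s: "s x \<in> C" and le: "ereal \<delta> * (Gap F g X t x - ereal \<theta>) \<le> Gam F g t x (s x)"
    using lmo x by (auto simp: inexact_lmo_def)
  have Gam_s: "Gam F g t x (s x) = ereal (gap_tilde F g s t x)"
    using Gam_eq[of x "s x" t] C_D[OF x] C_D[OF s] by (simp add: gap_tilde_def)
  have upper: "Gam F g t x y \<le> Gap F g X t x" if "y \<in> X" for y
    unfolding Gap_def using that by (rule SUP_upper)
  have "Gap F g X t x \<noteq> -\<infinity>" using upper[of "s x"] C_D[OF s] Gam_s by auto
  moreover have "Gap F g X t x \<noteq> \<infinity>" using le \<delta> by (auto simp: Gam_s)
  ultimately obtain G where G: "Gap F g X t x = ereal G" by (cases "Gap F g X t x") auto
  show "real_of_ereal (Gap F g X t x) \<le> gap_tilde F g s t x / \<delta> + \<theta>"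
    using le \<delta> by (simp add: G Gam_s field_simps)
  fix y assume "y \<in> X" "y \<in> edom g"
  then show "dir1 \<Phi> x (x - y) / t + gr x - gr y \<le> real_of_ereal (Gap F g X t x)"
    using upper[of y] Gam_eq[of x y t] C_D[OF x] by (simp add: G)
qed

text \<open>This is \<open>t\<close> times the penalized objective \<open>F / t + g\<close> whose Frank-Wolfe gap is \<open>Gap F g X t\<close>.\<close>

definition potential :: "real \<Rightarrow> 'e \<Rightarrow> real" where
  "potential t x = \<Phi> x + t * gr x"

text \<open>To first order the step lowers the barrier and the convex term together by at least
  \<open>\<alpha> * u\<close>, and self-concordance leaves at least half of this.\<close>

lemma potential_step:
  assumes x: "x \<in> C" and sx: "s x \<in> C" and r: "0 < r" "r \<le> 1" and t: "t = \<nu> / \<Omega> / r"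
    and \<delta>: "0 < \<delta>" "\<delta> \<le> 1" and large: "gap_tilde F g s t x > 2 * \<Omega> * r * \<delta>"
  defines "x' \<equiv> x + alpha_tilde F g s t x *\<^sub>R (s x - x)"
  shows "x' \<in> C" "potential t x' \<le> potential t x - min (\<nu> * \<delta>) (\<delta>\<^sup>2 / 60) * r\<^sup>2"
proof -
  have t0: "t > 0" using t \<nu>_pos Omega_pos r by simp
  have t\<Omega>: "t * \<Omega> = \<nu> / r" using t Omega_pos by simp
  define u where "u = t * gap_tilde F g s t x"
  have u: "u = dir1 \<Phi> x (x - s x) + t * (gr x - gr (s x))"
    using Gam_eq[of x "s x" t] C_D[OF x] C_D[OF sx] t0
    by (simp add: u_def gap_tilde_def field_simps)
  have "t * (2 * \<Omega> * r * \<delta>) < u" unfolding u_def using large t0 by (intro mult_strict_left_mono)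
  \<comment> \<open>The choice of \<open>t\<close> and of the threshold makes their product the same
    at every stage.\<close>
  moreover have "t * (2 * \<Omega> * r * \<delta>) = 2 * \<nu> * \<delta>" using t r Omega_pos by simp
  ultimately have u_ge: "2 * \<nu> * \<delta> < u" by simp
  moreover have "0 < 2 * \<nu> * \<delta>" using \<nu>_pos \<delta> by simp
  ultimately have u0: "0 < u" by linarith
  define e where "e = e_tilde F s x"
  have e: "e = sqrt (dir2 \<Phi> x (s x - x) (s x - x))" by (simp add: e_def e_tilde_def)
  have e0: "0 \<le> e" using dir2_nonneg C_D(2)[OF x] by (simp add: e)
  define \<alpha> where "\<alpha> = alpha_tilde F g s t x"
  have \<alpha>: "\<alpha> = (if e = 0 then 1 else min 1 (u / (e * (e + u))))"
    by (simp add: \<alpha>_def alpha_tilde_def Let_def u_def e_def)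
  note dec = step_length_decrease[OF e0 u0 \<alpha>]
  show "x' \<in> C" unfolding x'_def \<alpha>_def[symmetric] by (intro step_mem_C x sx dec)
  \<comment> \<open>The variation of \<open>g\<close> separates the barrier part from
    \<open>u\<close>, as needed to bound the local norm \<open>e\<close>.\<close>
  have "t * (gr (s x) - gr x) \<le> t * \<Omega>"
    using g_variation[of "s x" x] C_D[OF x] C_D[OF sx] t0 by (intro mult_left_mono) auto
  then have "dir1 \<Phi> x (x - s x) \<le> \<nu> / r + u" using t\<Omega> by (simp add: u right_diff_distrib)
  with local_norm_diff_le[OF C_D(2)[OF x] C_D(2)[OF sx]]
  have e_le: "e \<le> 2 * (2 * \<nu> + \<nu> / r + u)" by (simp add: e)
  have "\<Phi> x' \<le> \<Phi> x + \<alpha> * dir1 \<Phi> x (s x - x) + (\<alpha> * e)\<^sup>2 / (2 * (1 - \<alpha> * e))"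
    unfolding x'_def \<alpha>_def[symmetric] by (intro descent e dec C_D x sx)
  moreover have "t * gr x' \<le> t * (gr x + \<alpha> * (gr (s x) - gr x))"
    unfolding x'_def \<alpha>_def[symmetric] using t0 by (intro mult_left_mono g_convex dec C_D x sx) auto
  moreover have "dir1 \<Phi> x (s x - x) = - dir1 \<Phi> x (x - s x)"
    using C_D(2)[OF x] by (simp add: dir1_diff)
  ultimately have "potential t x' \<le> potential t x - \<alpha> * u + (\<alpha> * e)\<^sup>2 / (2 * (1 - \<alpha> * e))"
    by (simp add: potential_def u algebra_simps)
  also have "\<dots> \<le> potential t x - \<alpha> * u / 2" using dec(4) by linarith
  also have "\<dots> \<le> potential t x - min (\<nu> * \<delta>) (\<delta>\<^sup>2 / 60) * r\<^sup>2"
    using step_length_decrease_ge[OF e0 \<nu>_pos \<delta> r _ e_le \<alpha>] u_ge by simp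
  finally show "potential t x' \<le> potential t x - min (\<nu> * \<delta>) (\<delta>\<^sup>2 / 60) * r\<^sup>2" .
qed

text \<open>Each step costs the fixed amount of \<open>potential_step\<close>, while
  \<open>D\<close> limits the total drop over \<open>C\<close>.\<close>

lemma icg_terminates:
  assumes r: "0 < r" "r \<le> 1" and t: "t = \<nu> / \<Omega> / r" and \<delta>: "0 < \<delta>" "\<delta> \<le> 1"
    and lmo: "inexact_lmo F g X \<delta> \<theta> t s" and x: "x \<in> C"
    and D: "\<And>z. z \<in> C \<Longrightarrow> potential t x - potential t z \<le> D"
  shows "\<exists>k z. icg F g s t (2 * \<Omega> * r) \<delta> x = Some (k, z) \<and> z \<in> C \<and>
    gap_tilde F g s t z \<le> 2 * \<Omega> * r * \<delta> \<and> real k * (min (\<nu> * \<delta>) (\<delta>\<^sup>2 / 60) * r\<^sup>2) \<le> D"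
proof -
  have lower: "potential t x - D \<le> potential t z" if "z \<in> C" for z using D[OF that] by linarith
  have "0 < min (\<nu> * \<delta>) (\<delta>\<^sup>2 / 60) * r\<^sup>2" using \<nu>_pos \<delta> r by simp
  from while_option_potential[where I = "\<lambda>z. z \<in> C" and W = "potential t" and L = "potential t x - D"
      and b = "\<lambda>x. gap_tilde F g s t x > 2 * \<Omega> * r * \<delta>"
      and c = "\<lambda>x. x + alpha_tilde F g s t x *\<^sub>R (s x - x)", OF x this _ lower]
  obtain k z where "icg F g s t (2 * \<Omega> * r) \<delta> x = Some (k, z)" "z \<in> C"
      "gap_tilde F g s t z \<le> 2 * \<Omega> * r * \<delta>"
      "real k * (min (\<nu> * \<delta>) (\<delta>\<^sup>2 / 60) * r\<^sup>2) \<le> potential t x - potential t z"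
    using potential_step[OF _ _ r t \<delta>] lmo unfolding icg_def inexact_lmo_def by (auto simp: not_less)
  with D[of z] show ?thesis by fastforce
qed

section \<open>Consequences of the stopping test\<close>

text \<open>The test contributes \<open>\<eta>\<close> and the additive oracle error, taken equal to
  it, contributes another \<open>\<eta>\<close>.\<close>

lemma stopping_gap:
  assumes \<delta>: "0 < \<delta>" and lmo: "inexact_lmo F g X \<delta> \<eta> t s" and z: "z \<in> C"
    and stop: "gap_tilde F g s t z \<le> \<eta> * \<delta>" and y: "y \<in> X" "y \<in> edom g"
  shows "dir1 \<Phi> z (z - y) / t + gr z - gr y \<le> 2 * \<eta>"
proof -
  have "gap_tilde F g s t z / \<delta> \<le> \<eta>" using stop \<delta> by (simp add: pos_divide_le_eq)
  with oracle_gap(1)[OF lmo \<delta> z] oracle_gap(2)[OF lmo \<delta> z y] show ?thesis by linarith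
qed

text \<open>The gap bound is \<open>4 * \<Omega> * r\<close>. Its barrier part is at least
  \<open>- \<nu> / t = - \<Omega> * r\<close>, because \<open>dir1 \<Phi> z z = - \<nu>\<close> and
  \<open>dir1 \<Phi> z y \<le> 0\<close>.\<close>

lemma stopping_value:
  assumes r: "0 < r" and t: "t = \<nu> / \<Omega> / r" and \<delta>: "0 < \<delta>"
    and lmo: "inexact_lmo F g X \<delta> (2 * \<Omega> * r) t s" and z: "z \<in> C"
    and stop: "gap_tilde F g s t z \<le> 2 * \<Omega> * r * \<delta>"
    and y: "y \<in> X" "y \<in> Kc" "y \<in> edom g"
  shows "gr z - gr y \<le> 5 * \<Omega> * r"
proof -
  have "closure (interior Kc) = Kc"
    using barrier by (simp add: canonical_barrier_def convex_closure_interior)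
  then have "dir1 \<Phi> z y \<le> 0" using dir1_nonpos_closure[OF C_D(2)[OF z]] y by simp
  then have "- \<nu> \<le> dir1 \<Phi> z (z - y)" using C_D(2)[OF z] by (simp add: dir1_diff dir1_self)
  moreover have "t > 0" using t r \<nu>_pos Omega_pos by simp
  ultimately have "- \<nu> / t \<le> dir1 \<Phi> z (z - y) / t" by (intro divide_right_mono) auto
  moreover have "- \<nu> / t = - (\<Omega> * r)" using t \<nu>_pos Omega_pos r by simp
  ultimately show ?thesis using stopping_gap[OF \<delta> lmo z stop y(1,3)] by simp
qed

text \<open>Split \<open>t / \<sigma>\<close> into \<open>t\<close> and
  \<open>t / \<sigma> - t\<close>. The first part is controlled by \<open>t\<close> times the gap,
  that is \<open>4 * \<nu>\<close>, and the second by \<open>stopping_value\<close>.\<close>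

lemma next_stage_potential:
  assumes r: "0 < r" and t: "t = \<nu> / \<Omega> / r" and \<delta>: "0 < \<delta>" and \<sigma>: "0 < \<sigma>" "\<sigma> < 1"
    and lmo: "inexact_lmo F g X \<delta> (2 * \<Omega> * r) t s" and z: "z \<in> C"
    and stop: "gap_tilde F g s t z \<le> 2 * \<Omega> * r * \<delta>" and y: "y \<in> C"
  shows "potential (t / \<sigma>) z - potential (t / \<sigma>) y \<le> 4 * \<nu> + 5 * \<nu> / \<sigma>"
proof -
  note z' = C_D[OF z] and y' = C_D[OF y]
  have t0: "t > 0" using t r \<nu>_pos Omega_pos by simp
  have "t * (dir1 \<Phi> z (z - y) / t + gr z - gr y) \<le> t * (2 * (2 * \<Omega> * r))"
    using stopping_gap[OF \<delta> lmo z stop y'(1,3)] t0 by (intro mult_left_mono) auto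
  moreover have "t * (2 * (2 * \<Omega> * r)) = 4 * \<nu>" using t r Omega_pos by simp
  ultimately have "dir1 \<Phi> z (z - y) + t * (gr z - gr y) \<le> 4 * \<nu>"
    using t0 by (simp add: algebra_simps)
  moreover have "\<Phi> z - \<Phi> y \<le> dir1 \<Phi> z (z - y)"
    using tangent[OF z'(2) y'(2)] z'(2) by (simp add: dir1_diff)
  moreover have "(t / \<sigma> - t) * (gr z - gr y) \<le> 5 * \<nu> / \<sigma>"
  proof -
    have "y \<in> Kc" using y'(2) interior_subset by blast
    then have "gr z - gr y \<le> 5 * \<Omega> * r"
      by (intro stopping_value[OF r t \<delta> lmo z stop] y')
    moreover have "t \<le> t / \<sigma>" using t0 \<sigma> by (simp add: pos_le_divide_eq)
    ultimately have "(t / \<sigma> - t) * (gr z - gr y) \<le> (t / \<sigma> - t) * (5 * \<Omega> * r)"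
      by (intro mult_left_mono) auto
    also have "\<dots> \<le> t / \<sigma> * (5 * \<Omega> * r)"
      using t0 Omega_pos r by (intro mult_right_mono) auto
    also have "\<dots> = 5 * \<nu> / \<sigma>" using t r Omega_pos by simp
    finally show ?thesis .
  qed
  ultimately show ?thesis by (simp add: potential_def algebra_simps)
qed

subsection \<open>The homotopy method\<close>

text \<open>\<open>M\<close> is the larger of the bounds on the initial potential gap, for stage 0
  and for later stages, divided by the decrease per step at \<open>r = 1\<close>. Stage
  \<open>i\<close> thus takes at most \<open>M / (\<sigma> ^ i) ^ 2\<close> steps.\<close>

lemma homotopy_run:
  assumes \<sigma>: "0 < \<sigma>" "\<sigma> < 1" and \<delta>: "0 < \<delta>" "\<delta> \<le> 1" and x0: "x0 \<in> C"
    and lmos: "\<And>i. i \<le> m \<Longrightarrow>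
      inexact_lmo F g X \<delta> (2 * \<Omega> * \<sigma> ^ i) (\<nu> / \<Omega> / \<sigma> ^ i) (s (\<nu> / \<Omega> / \<sigma> ^ i))"
    and M: "M = max (\<nu> / \<Omega> * real_of_ereal (Gap F g X (\<nu> / \<Omega>) x0)) (4 * \<nu> + 5 * \<nu> / \<sigma>)
      / min (\<nu> * \<delta>) (\<delta>\<^sup>2 / 60)"
    and i: "i \<le> m"
  shows "\<exists>n z. homotopy_stage F g s (\<nu> / \<Omega>) (2 * \<Omega>) \<sigma> \<delta> x0 i = Some (n, z) \<and> z \<in> C \<and>
    gap_tilde F g (s (\<nu> / \<Omega> / \<sigma> ^ i)) (\<nu> / \<Omega> / \<sigma> ^ i) z \<le> 2 * \<Omega> * \<sigma> ^ i * \<delta> \<and>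
    real n \<le> M / (1 - \<sigma>\<^sup>2) / (\<sigma> ^ i)\<^sup>2"
  using i
proof (induction i)
  let ?d = "min (\<nu> * \<delta>) (\<delta>\<^sup>2 / 60)"
  have d: "?d > 0" using \<nu>_pos \<delta> by simp
  have \<sigma>2: "0 < \<sigma>\<^sup>2" "\<sigma>\<^sup>2 < 1" using \<sigma> by (auto simp: power_less_one_iff)
  {
    case 0
    define t where "t = \<nu> / \<Omega>"
    have t: "t > 0" using \<nu>_pos Omega_pos by (simp add: t_def)
    have lmo: "inexact_lmo F g X \<delta> (2 * \<Omega>) t (s t)" using lmos[of 0] by (simp add: t_def)
    \<comment> \<open>Stage 0 has no preceding stopping test, so the gap at \<open>x0\<close> itself
      bounds the initial potential gap.\<close>
    have D: "potential t x0 - potential t z \<le> t * real_of_ereal (Gap F g X t x0)" if z: "z \<in> C" for z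
    proof -
      have "\<Phi> x0 - \<Phi> z \<le> dir1 \<Phi> x0 (x0 - z)"
        using tangent[of x0 z] C_D[OF x0] C_D[OF z] by (simp add: dir1_diff)
      then have "potential t x0 - potential t z \<le> t * (dir1 \<Phi> x0 (x0 - z) / t + gr x0 - gr z)"
        using t by (simp add: potential_def algebra_simps)
      also have "\<dots> \<le> t * real_of_ereal (Gap F g X t x0)"
        using oracle_gap(2)[OF lmo \<delta>(1) x0] C_D[OF z] t by (intro mult_left_mono) auto
      finally show ?thesis .
    qed
    from icg_terminates[of 1 t, OF _ _ _ \<delta> lmo x0 D]
    obtain k z where *: "icg F g (s t) t (2 * \<Omega>) \<delta> x0 = Some (k, z)" "z \<in> C"
        "gap_tilde F g (s t) t z \<le> 2 * \<Omega> * \<delta>" "real k * ?d \<le> t * real_of_ereal (Gap F g X t x0)"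
      by (auto simp: t_def)
    have "real k \<le> M" using *(4) d by (simp add: M t_def pos_le_divide_eq)
    also have "\<dots> \<le> M / (1 - \<sigma>\<^sup>2)"
    proof -
      have "0 \<le> M" using \<open>real k \<le> M\<close> by linarith
      then show ?thesis using \<sigma>2 by (simp add: pos_le_divide_eq mult_left_le)
    qed
    finally show ?case using * by (simp add: t_def)
  next
    case (Suc i)
    define r where "r = \<sigma> ^ i"
    have r: "0 < r" "r \<le> 1" using \<sigma> by (auto simp: r_def power_le_one)
    have r': "0 < r * \<sigma>" "r * \<sigma> \<le> 1" using r \<sigma> by (auto intro: mult_le_one)
    define t where "t = \<nu> / \<Omega> / r"
    have t': "t / \<sigma> = \<nu> / \<Omega> / (r * \<sigma>)" by (simp add: t_def)
    have lmo: "inexact_lmo F g X \<delta> (2 * \<Omega> * r) t (s t)"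
      using lmos[of i] Suc.prems by (simp add: t_def r_def)
    have lmo': "inexact_lmo F g X \<delta> (2 * \<Omega> * (r * \<sigma>)) (t / \<sigma>) (s (t / \<sigma>))"
      using lmos[of "Suc i"] Suc.prems by (simp add: t' r_def mult.commute)
    from Suc obtain n x where n: "homotopy_stage F g s (\<nu> / \<Omega>) (2 * \<Omega>) \<sigma> \<delta> x0 i = Some (n, x)"
        "x \<in> C" "gap_tilde F g (s t) t x \<le> 2 * \<Omega> * r * \<delta>"
        "real n \<le> M / (1 - \<sigma>\<^sup>2) / r\<^sup>2"
      by (auto simp: t_def r_def)
    from icg_terminates[OF r' t' \<delta> lmo' n(2)
        next_stage_potential[OF r(1) t_def \<delta>(1) \<sigma> lmo n(2,3)]]
    obtain k z where k: "icg F g (s (t / \<sigma>)) (t / \<sigma>) (2 * \<Omega> * (r * \<sigma>)) \<delta> x = Some (k, z)" "z \<in> C"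
        "gap_tilde F g (s (t / \<sigma>)) (t / \<sigma>) z \<le> 2 * \<Omega> * (r * \<sigma>) * \<delta>"
        "real k * (?d * (r * \<sigma>)\<^sup>2) \<le> 4 * \<nu> + 5 * \<nu> / \<sigma>"
      by auto
    have "real k * (r * \<sigma>)\<^sup>2 * ?d \<le> 4 * \<nu> + 5 * \<nu> / \<sigma>"
      using k(4) by (simp only: mult_ac)
    also have "\<dots> \<le> M * ?d"
    proof -
      have "?d \<noteq> 0" using d by linarith
      from nonzero_eq_divide_eq[THEN iffD1, OF this M] show ?thesis by simp
    qed
    finally have "real k * (r * \<sigma>)\<^sup>2 * ?d \<le> M * ?d" .
    then have "real k * (r * \<sigma>)\<^sup>2 \<le> M" using d by (simp only: mult_le_cancel_right_pos)
    then have "real k \<le> M / (r * \<sigma>)\<^sup>2"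
      by (simp only: pos_le_divide_eq[OF zero_less_power[OF r'(1)]])
    with n(4) have "real (n + k) \<le> M / (1 - \<sigma>\<^sup>2) / r\<^sup>2 + M / (r * \<sigma>)\<^sup>2" by simp
    \<comment> \<open>One step of the geometric sum, as \<open>\<sigma> ^ 2 / (1 - \<sigma> ^ 2) + 1
      = 1 / (1 - \<sigma> ^ 2)\<close>.\<close>
    also have "\<dots> = M / (1 - \<sigma>\<^sup>2) / (r * \<sigma>)\<^sup>2"
      using \<sigma>2 \<sigma> r by (simp add: divide_simps power_mult_distrib) (simp add: algebra_simps)
    finally have "real (n + k) \<le> M / (1 - \<sigma>\<^sup>2) / (r * \<sigma>)\<^sup>2" .
    moreover have "\<nu> / \<Omega> / \<sigma> ^ Suc i = t / \<sigma>" "2 * \<Omega> * \<sigma> ^ Suc i = 2 * \<Omega> * (r * \<sigma>)"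
      "\<sigma> ^ Suc i = r * \<sigma>"
      by (simp_all add: t_def r_def mult.commute)
    ultimately show ?case using n(1) k
      by (simp only: homotopy_stage.simps Option.bind.simps split_conv) auto
  }
qed

end

section \<open>Number of stages and final estimates\<close>

text \<open>Rounding up to an integer index costs at most one factor \<sigma>. The first bound
  yields accuracy and the second complexity; for \<open>\<epsilon> > 3 * \<eta>\<close> the index is
  truncated to 0, hence the premise of the second.\<close>

lemma last_stage_bounds:
  assumes \<sigma>: "0 < \<sigma>" "\<sigma> < 1" and \<eta>: "0 < \<eta>" and \<epsilon>: "0 < \<epsilon>"
  shows "3 * \<eta> * \<sigma> ^ last_stage \<eta> \<sigma> \<epsilon> \<le> \<epsilon>"
    and "\<epsilon> \<le> 3 * \<eta> \<Longrightarrow> \<epsilon> * \<sigma> \<le> 3 * \<eta> * \<sigma> ^ last_stage \<eta> \<sigma> \<epsilon>"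
proof -
  define L where "L = ln (3 * \<eta> / \<epsilon>)"
  define l where "l = ln (1 / \<sigma>)"
  define m where "m = last_stage \<eta> \<sigma> \<epsilon>"
  have m: "m = nat \<lceil>L / l\<rceil>" by (simp add: m_def L_def l_def last_stage_def)
  have l: "l > 0" using \<sigma> by (simp add: l_def)
  have pow: "3 * \<eta> * \<sigma> ^ m = \<epsilon> * exp (L - real m * l)"
  proof -
    have "exp (L - real m * l) = 3 * \<eta> / \<epsilon> / exp l ^ m"
      using \<eta> \<epsilon> by (simp add: exp_diff L_def exp_of_nat_mult)
    also have "exp l = 1 / \<sigma>" using \<sigma> by (simp add: l_def)
    finally show ?thesis using \<epsilon> \<sigma> by (simp add: power_one_over)
  qed
  have "L / l \<le> real m" unfolding m by linarith
  then have "L - real m * l \<le> 0" using l by (simp add: pos_divide_le_eq)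
  then show "3 * \<eta> * \<sigma> ^ last_stage \<eta> \<sigma> \<epsilon> \<le> \<epsilon>" using \<epsilon> pow by (simp add: m_def)
  assume "\<epsilon> \<le> 3 * \<eta>"
  then have "0 \<le> L" using \<epsilon> by (simp add: L_def)
  then have "0 \<le> L / l" using l by simp
  then have "real m \<le> L / l + 1" unfolding m by linarith
  then have "real m \<le> (L + l) / l" using l by (simp add: add_divide_distrib)
  then have "- l \<le> L - real m * l" using l by (simp add: pos_le_divide_eq)
  then have "exp (- l) \<le> exp (L - real m * l)" by simp
  moreover have "exp (- l) = \<sigma>" using \<sigma> by (simp add: l_def exp_minus)
  ultimately show "\<epsilon> * \<sigma> \<le> 3 * \<eta> * \<sigma> ^ last_stage \<eta> \<sigma> \<epsilon>" using \<epsilon> pow by (simp add: m_def)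
qed

theorem theorem4p4:
  fixes g :: "'e::euclidean_space \<Rightarrow> ereal"
    and f :: "'h::euclidean_space \<Rightarrow> ereal"
    and P :: "'e \<Rightarrow> 'h" and F :: "'e \<Rightarrow> ereal"
    and K :: "'h set" and X :: "'e set" and x0 :: 'e
    and \<nu> \<Omega> \<sigma> \<delta> t0 \<eta>0 \<theta>0 :: real
  assumes g: "proper_fun g" "closed_fun g" "convex_fun g" "continuous_on (edom g) g"
    and Omega: "Omega_g g X = ereal \<Omega>" "\<Omega> > 0"
    and K: "closed K" "convex K" "cone K" "pointed K" "interior K \<noteq> {}"
    and f: "canonical_barrier \<nu> K f"
    and P: "linear P"
    and F: "F = (\<lambda>x. f (P x))" "canonical_barrier \<nu> (P -` K) F" "edom F = interior (P -` K)"
    and X: "X \<noteq> {}" "compact X" "convex X"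
    and C: "Cset F g X \<noteq> {}"
    and x0: "x0 \<in> Cset F g X"
    and \<sigma>: "0 < \<sigma>" "\<sigma> < 1"
    and \<delta>: "0 < \<delta>" "\<delta> \<le> 1"
    and t0: "t0 = \<nu> / \<Omega>"
    and \<eta>0: "\<eta>0 = 2 * \<Omega>" and \<theta>0: "\<theta>0 = \<eta>0"
  shows
    "(\<forall>\<epsilon>>0. \<forall>s. homotopy_oracle F g X t0 \<eta>0 \<theta>0 \<sigma> \<delta> \<epsilon> s \<longrightarrow>
        (\<exists>n z. inexact_homotopy F g s t0 \<eta>0 \<sigma> \<delta> x0 \<epsilon> = Some (n, z) \<and> eps_solution g X P K \<epsilon> z))
     \<and> (\<forall>s. (\<forall>\<epsilon>>0. homotopy_oracle F g X t0 \<eta>0 \<theta>0 \<sigma> \<delta> \<epsilon> (s \<epsilon>)) \<longrightarrow>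
        (\<lambda>\<epsilon>. real (Compl F g (s \<epsilon>) t0 \<eta>0 \<sigma> \<delta> x0 \<epsilon>))
          \<in> O[at_right 0](\<lambda>\<epsilon>. \<nu> * \<Omega>\<^sup>2 / (\<delta>\<^sup>2 * \<epsilon>\<^sup>2 * (1 - \<sigma>\<^sup>2))))"
proof -
  have \<nu>: "\<nu> > 0" by (rule canonical_barrier_parameter_pos[OF K(4) f])
  interpret barrier_problem g F "P -` K" X \<nu> \<Omega>
    by unfold_locales (use g Omega F X \<nu> in auto)
  \<comment> \<open>This constant depends neither on \<epsilon> nor on the oracle, so one bound
    serves all runs.\<close>
  define M where "M = max (\<nu> / \<Omega> * real_of_ereal (Gap F g X (\<nu> / \<Omega>) x0)) (4 * \<nu> + 5 * \<nu> / \<sigma>)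
    / min (\<nu> * \<delta>) (\<delta>\<^sup>2 / 60)"
  have M0: "0 \<le> M" using \<nu> \<sigma> \<delta> by (simp add: M_def le_max_iff_disj)
  have \<eta>: "\<eta>0 > 0" using \<eta>0 Omega_pos by simp
  have run: "\<exists>n z. inexact_homotopy F g s t0 \<eta>0 \<sigma> \<delta> x0 \<epsilon> = Some (n, z) \<and>
      eps_solution g X P K \<epsilon> z \<and>
      real n \<le> M / (1 - \<sigma>\<^sup>2) / (\<sigma> ^ last_stage \<eta>0 \<sigma> \<epsilon>)\<^sup>2"
    if \<epsilon>: "\<epsilon> > 0" and lmos: "homotopy_oracle F g X t0 \<eta>0 \<theta>0 \<sigma> \<delta> \<epsilon> s" for \<epsilon> s
  proof -
    define m where "m = last_stage \<eta>0 \<sigma> \<epsilon>"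
    have lmo: "inexact_lmo F g X \<delta> (2 * \<Omega> * \<sigma> ^ i) (\<nu> / \<Omega> / \<sigma> ^ i) (s (\<nu> / \<Omega> / \<sigma> ^ i))"
      if "i \<le> m" for i
      using lmos that by (simp add: homotopy_oracle_def m_def \<theta>0 \<eta>0 t0)
    have "\<exists>n z. homotopy_stage F g s (\<nu> / \<Omega>) (2 * \<Omega>) \<sigma> \<delta> x0 m = Some (n, z) \<and> z \<in> Cset F g X \<and>
      gap_tilde F g (s (\<nu> / \<Omega> / \<sigma> ^ m)) (\<nu> / \<Omega> / \<sigma> ^ m) z \<le> 2 * \<Omega> * \<sigma> ^ m * \<delta> \<and>
      real n \<le> M / (1 - \<sigma>\<^sup>2) / (\<sigma> ^ m)\<^sup>2"
      by (rule homotopy_run[OF \<sigma> \<delta> x0 lmo M_def order.refl])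
    then obtain n z where n: "inexact_homotopy F g s t0 \<eta>0 \<sigma> \<delta> x0 \<epsilon> = Some (n, z)" "z \<in> Cset F g X"
      "gap_tilde F g (s (\<nu> / \<Omega> / \<sigma> ^ m)) (\<nu> / \<Omega> / \<sigma> ^ m) z \<le> 2 * \<Omega> * \<sigma> ^ m * \<delta>"
      "real n \<le> M / (1 - \<sigma>\<^sup>2) / (\<sigma> ^ m)\<^sup>2"
      unfolding inexact_homotopy_def m_def t0 \<eta>0 by blast
    have zK: "P z \<in> K" using C_D(2)[OF n(2)] interior_subset by blast
    have "0 < \<sigma> ^ m" using \<sigma> by simp
    note val = stopping_value[OF this refl \<delta>(1) lmo[OF order.refl] n(2,3)]
    \<comment> \<open>The right-hand side is \<open>6 * \<Omega> * \<sigma> ^ m\<close>, which the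
      choice of the last stage keeps below \<epsilon>.\<close>
    have "5 * \<Omega> * \<sigma> ^ m \<le> 3 * \<eta>0 * \<sigma> ^ m" using \<sigma> Omega_pos by (simp add: \<eta>0)
    with last_stage_bounds(1)[OF \<sigma> \<eta> \<epsilon>] have acc: "5 * \<Omega> * \<sigma> ^ m \<le> \<epsilon>" by (simp add: m_def)
    have gz: "g z = ereal (fin g z)" by (rule g_eq[OF C_D(3)[OF n(2)]])
    \<comment> \<open>A finite lower bound also excludes the value \<open>-\<infinity>\<close>, so
      the extended-real subtraction is harmless.\<close>
    have "ereal (fin g z - \<epsilon>) \<le> Opt g X P K"
      unfolding Opt_def
    proof (rule INF_greatest)
      fix y assume y: "y \<in> {x \<in> X. P x \<in> K}"
      show "ereal (fin g z - \<epsilon>) \<le> g y"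
      proof (cases "y \<in> edom g")
        case True
        then have "fin g z - \<epsilon> \<le> fin g y" using val[of y] y acc by auto
        then show ?thesis by (simp add: g_eq[OF True])
      qed (simp add: edom_def)
    qed
    then have "g z - Opt g X P K \<le> ereal \<epsilon>"
      unfolding gz by (cases "Opt g X P K") auto
    then have "eps_solution g X P K \<epsilon> z"
      using C_D(1)[OF n(2)] zK by (simp add: eps_solution_def)
    with n show ?thesis by (auto simp: m_def)
  qed
  have "(\<lambda>\<epsilon>. real (Compl F g (s \<epsilon>) t0 \<eta>0 \<sigma> \<delta> x0 \<epsilon>))
      \<in> O[at_right 0](\<lambda>\<epsilon>. \<nu> * \<Omega>\<^sup>2 / (\<delta>\<^sup>2 * \<epsilon>\<^sup>2 * (1 - \<sigma>\<^sup>2)))"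
    if s: "\<And>\<epsilon>. \<epsilon> > 0 \<Longrightarrow> homotopy_oracle F g X t0 \<eta>0 \<theta>0 \<sigma> \<delta> \<epsilon> (s \<epsilon>)" for s
  proof (rule bigoI)
    \<comment> \<open>The factor 36 is the square of 6 in
      \<open>\<epsilon> * \<sigma> / (6 * \<Omega>) \<le> p\<close>; the remaining factors convert
      to the stated order. Only \<epsilon> varies, so \<open>c\<close> may depend on the other
      data.\<close>
    define c where "c = M * 36 * \<delta>\<^sup>2 / (\<sigma>\<^sup>2 * \<nu>)"
    have \<sigma>2: "\<sigma>\<^sup>2 < 1" using \<sigma> by (auto simp: power_less_one_iff)
    show "\<forall>\<^sub>F \<epsilon> in at_right 0. norm (real (Compl F g (s \<epsilon>) t0 \<eta>0 \<sigma> \<delta> x0 \<epsilon>))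
        \<le> c * norm (\<nu> * \<Omega>\<^sup>2 / (\<delta>\<^sup>2 * \<epsilon>\<^sup>2 * (1 - \<sigma>\<^sup>2)))"
      unfolding eventually_at_right_field
    \<comment> \<open>Below this threshold the second bound of \<open>last_stage_bounds\<close> is
      available.\<close>
    proof (intro exI[of _ "3 * \<eta>0"] conjI allI impI)
      fix \<epsilon> :: real assume \<epsilon>: "0 < \<epsilon>" "\<epsilon> < 3 * \<eta>0"
      define p where "p = \<sigma> ^ last_stage \<eta>0 \<sigma> \<epsilon>"
      have "real (Compl F g (s \<epsilon>) t0 \<eta>0 \<sigma> \<delta> x0 \<epsilon>) \<le> M / (1 - \<sigma>\<^sup>2) / p\<^sup>2"
        using run[OF \<epsilon>(1) s[OF \<epsilon>(1)]] by (auto simp: Compl_def p_def)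
      also have "\<dots> \<le> M / (1 - \<sigma>\<^sup>2) / (\<epsilon> * \<sigma> / (6 * \<Omega>))\<^sup>2"
      proof (intro divide_left_mono power_mono)
        show "\<epsilon> * \<sigma> / (6 * \<Omega>) \<le> p"
          using last_stage_bounds(2)[OF \<sigma> \<eta> \<epsilon>(1)] \<epsilon> Omega_pos
          by (simp add: p_def \<eta>0 pos_divide_le_eq mult.commute mult.left_commute)
      qed (use M0 \<sigma>2 \<epsilon> \<sigma> Omega_pos in \<open>auto simp: p_def\<close>)
      also have "\<dots> = c * (\<nu> * \<Omega>\<^sup>2 / (\<delta>\<^sup>2 * \<epsilon>\<^sup>2 * (1 - \<sigma>\<^sup>2)))"
        using \<nu> \<delta> \<sigma> \<sigma>2 \<epsilon> Omega_pos by (simp add: c_def power_mult_distrib power_divide)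
      also have "\<dots> = c * norm (\<nu> * \<Omega>\<^sup>2 / (\<delta>\<^sup>2 * \<epsilon>\<^sup>2 * (1 - \<sigma>\<^sup>2)))"
        using \<nu> \<sigma>2 by simp
      finally show "norm (real (Compl F g (s \<epsilon>) t0 \<eta>0 \<sigma> \<delta> x0 \<epsilon>))
        \<le> c * norm (\<nu> * \<Omega>\<^sup>2 / (\<delta>\<^sup>2 * \<epsilon>\<^sup>2 * (1 - \<sigma>\<^sup>2)))" by simp
    qed (use \<eta> in simp)
  qed
  with run show ?thesis by blast
qed

end
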